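(* Let $R$ be a commutative ring and $\mathcal{D}$ an $R$-linear triangulated category. Assume $\mathcal{D}$ has coproducts and let $M:\mathcal{D}\to\mathrm{Mod}\text{-}R$ be a contravariant functor. Suppose that there is a set $\mathcal{G}$ of objects in $\mathcal{D}$ such that $\mathcal{D}=\mathcal{A}^{*n}$ for some $n\geq1$, where $\mathcal{A}=\mathrm{Add}\,\mathcal{G}[\mathbb{Z}]$. Then $M$ is representable if and only if $M$ is cohomological and sends coproducts into products.
   Context: All functors are $R$-linear. A contravariant functor $M$ is cohomological if it sends each triangle $X\to Y\to Z\to X[1]$ to an exact sequence $M(Z)\to M(Y)\to M(X)$; it is representable if $M\cong\mathcal{D}(-,X)$ for some $X\in\mathcal{D}$. $\mathcal{G}[\mathbb{Z}]=\{G[n]\mid G\in\mathcal{G},n\in\mathbb{Z}\}$, and $\mathrm{Add}\,\mathcal{G}[\mathbb{Z}]$ is the full subcategory of all direct summands of (arbitrary set-indexed) coproducts of objects of $\mathcal{G}[\mathbb{Z}]$. For subcategories $\mathcal{A},\mathcal{B}\subseteq\mathcal{D}$, $\mathrm{smd}\,\mathcal{A}$ is the closure of $\mathcal{A}$ under direct summands and $\mathcal{A}*\mathcal{B}$ is the class of $Y\in\mathcal{D}$ for which there is a triangle $X\to Y\to Z\to X[1]$ with $X\in\mathcal{A}$, $Z\in\mathcal{B}$. Put $\mathcal{A}^{*1}=\mathrm{smd}\,\mathcal{A}$ and $\mathcal{A}^{*(n+1)}=\mathrm{smd}(\mathcal{A}^{*n}*\mathcal{A}^{*1})$ for $n\ge1$.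 *)

theory Defs
  imports "HOL-Algebra.Module" "HOL-Library.FuncSet"
begin

unbundle cardinal_syntax

text \<open>
  Size convention.  Objects and morphisms live in arbitrary types, and ``set'' (as opposed to
  ``class'') means ``of cardinality less than \<open>\<kappa>\<close>'' for an uncountable regular cardinal \<open>\<kappa>\<close>.
  If \<open>\<kappa>\<close> is an uncountable inaccessible cardinal, the \<open>\<kappa>\<close>-small sets are, up to bijection, the
  members of a Grothendieck universe.  No generality is gained by not asking \<open>\<kappa>\<close> to be a strong
  limit: if \<open>X\<close> is a nonzero object of a locally small category with coproducts, then the
  endomorphisms of a coproduct of copies of \<open>X\<close> indexed by \<open>I\<close> include a copy of the power set
  of \<open>I\<close>.
\<close>

definition universe_cardinal :: "'u rel \<Rightarrow> bool" where
  "universe_cardinal \<kappa> \<longleftrightarrow> Card_order \<kappa> \<and> regularCard \<kappa> \<and> natLeq <o \<kappa>"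

definition small :: "'u rel \<Rightarrow> 'a set \<Rightarrow> bool" where
  "small \<kappa> A \<longleftrightarrow> |A| <o \<kappa>"

definition linear_maps ::
    "('r, 's) ring_scheme \<Rightarrow> ('r, 'a, 'x) module_scheme \<Rightarrow> ('r, 'b, 'y) module_scheme \<Rightarrow> ('a \<Rightarrow> 'b) set"
  where
  "linear_maps R M N = {h \<in> carrier M \<rightarrow> carrier N.
     (\<forall>x\<in>carrier M. \<forall>y\<in>carrier M. h (x \<oplus>\<^bsub>M\<^esub> y) = h x \<oplus>\<^bsub>N\<^esub> h y) \<and>
     (\<forall>a\<in>carrier R. \<forall>x\<in>carrier M. h (a \<odot>\<^bsub>M\<^esub> x) = a \<odot>\<^bsub>N\<^esub> h x)}"

section \<open>Linear categories\<close>

text \<open>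
  The multiplicative fields of the records \<^term>\<open>Hom C X Y\<close> (and of the values of functors to
  modules) carry no meaning, as usual for the type \<^type>\<open>module_ext\<close>.  Hom-sets of distinct pairs
  of objects are disjoint, so composition needs no object arguments; \<open>g \<cdot> f\<close> is ``first \<open>f\<close>, then
  \<open>g\<close>''.
\<close>

record ('r, 'o, 'm) lin_cat =
  Ob :: "'o set"
  Hom :: "'o \<Rightarrow> 'o \<Rightarrow> ('r, 'm) module"
  ident :: "'o \<Rightarrow> 'm"
  cmp :: "'m \<Rightarrow> 'm \<Rightarrow> 'm"  (infixl \<open>\<cdot>\<index>\<close> 70)

abbreviation arrows :: "('r, 'o, 'm, 'z) lin_cat_scheme \<Rightarrow> 'o \<Rightarrow> 'o \<Rightarrow> 'm set" where
  "arrows C X Y \<equiv> carrier (Hom C X Y)"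

locale linear_category =
  fixes R :: "('r, 's) ring_scheme"
    and C :: "('r, 'o, 'm, 'z) lin_cat_scheme"
  assumes cring: "cring R"
    and Hom_module: "\<lbrakk>X \<in> Ob C; Y \<in> Ob C\<rbrakk> \<Longrightarrow> module R (Hom C X Y)"
    and Hom_disjoint: "\<lbrakk>X \<in> Ob C; Y \<in> Ob C; X' \<in> Ob C; Y' \<in> Ob C; f \<in> arrows C X Y;
      f \<in> arrows C X' Y'\<rbrakk> \<Longrightarrow> X = X' \<and> Y = Y'"
    and ident_arrow: "X \<in> Ob C \<Longrightarrow> ident C X \<in> arrows C X X"
    and cmp_ident_left: "\<lbrakk>X \<in> Ob C; Y \<in> Ob C; f \<in> arrows C X Y\<rbrakk> \<Longrightarrow> ident C Y \<cdot>\<^bsub>C\<^esub> f = f"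
    and cmp_ident_right: "\<lbrakk>X \<in> Ob C; Y \<in> Ob C; f \<in> arrows C X Y\<rbrakk> \<Longrightarrow> f \<cdot>\<^bsub>C\<^esub> ident C X = f"
    and cmp_assoc: "\<lbrakk>W \<in> Ob C; X \<in> Ob C; Y \<in> Ob C; Z \<in> Ob C;
      f \<in> arrows C W X; g \<in> arrows C X Y; h \<in> arrows C Y Z\<rbrakk>
      \<Longrightarrow> h \<cdot>\<^bsub>C\<^esub> (g \<cdot>\<^bsub>C\<^esub> f) = (h \<cdot>\<^bsub>C\<^esub> g) \<cdot>\<^bsub>C\<^esub> f"
    and cmp_linear_right: "\<lbrakk>X \<in> Ob C; Y \<in> Ob C; Z \<in> Ob C; g \<in> arrows C Y Z\<rbrakk>
      \<Longrightarrow> (\<lambda>f. g \<cdot>\<^bsub>C\<^esub> f) \<in> linear_maps R (Hom C X Y) (Hom C X Z)"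
    and cmp_linear_left: "\<lbrakk>X \<in> Ob C; Y \<in> Ob C; Z \<in> Ob C; f \<in> arrows C X Y\<rbrakk>
      \<Longrightarrow> (\<lambda>g. g \<cdot>\<^bsub>C\<^esub> f) \<in> linear_maps R (Hom C Y Z) (Hom C X Z)"

definition locally_small :: "'u rel \<Rightarrow> ('r, 'o, 'm, 'z) lin_cat_scheme \<Rightarrow> bool" where
  "locally_small \<kappa> C \<longleftrightarrow> (\<forall>X\<in>Ob C. \<forall>Y\<in>Ob C. small \<kappa> (arrows C X Y))"

definition is_iso :: "('r, 'o, 'm, 'z) lin_cat_scheme \<Rightarrow> 'o \<Rightarrow> 'o \<Rightarrow> 'm \<Rightarrow> bool" where
  "is_iso C X Y f \<longleftrightarrow> f \<in> arrows C X Y \<and>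
     (\<exists>g\<in>arrows C Y X. g \<cdot>\<^bsub>C\<^esub> f = ident C X \<and> f \<cdot>\<^bsub>C\<^esub> g = ident C Y)"

definition is_zero_object :: "('r, 'o, 'm, 'z) lin_cat_scheme \<Rightarrow> 'o \<Rightarrow> bool" where
  "is_zero_object C Z \<longleftrightarrow> Z \<in> Ob C \<and>
     (\<forall>X\<in>Ob C. (\<exists>!f. f \<in> arrows C Z X) \<and> (\<exists>!f. f \<in> arrows C X Z))"

definition is_biproduct :: "('r, 'o, 'm, 'z) lin_cat_scheme \<Rightarrow> 'o \<Rightarrow> 'o \<Rightarrow> 'o \<Rightarrow> bool" where
  "is_biproduct C X Y S \<longleftrightarrow> X \<in> Ob C \<and> Y \<in> Ob C \<and> S \<in> Ob C \<and>
     (\<exists>i\<in>arrows C X S. \<exists>j\<in>arrows C Y S. \<exists>p\<in>arrows C S X. \<exists>q\<in>arrows C S Y.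
        p \<cdot>\<^bsub>C\<^esub> i = ident C X \<and> q \<cdot>\<^bsub>C\<^esub> j = ident C Y \<and>
        p \<cdot>\<^bsub>C\<^esub> j = \<zero>\<^bsub>Hom C Y X\<^esub> \<and> q \<cdot>\<^bsub>C\<^esub> i = \<zero>\<^bsub>Hom C X Y\<^esub> \<and>
        (i \<cdot>\<^bsub>C\<^esub> p) \<oplus>\<^bsub>Hom C S S\<^esub> (j \<cdot>\<^bsub>C\<^esub> q) = ident C S)"

definition direct_summand :: "('r, 'o, 'm, 'z) lin_cat_scheme \<Rightarrow> 'o \<Rightarrow> 'o \<Rightarrow> bool" where
  "direct_summand C X S \<longleftrightarrow> (\<exists>Y\<in>Ob C. is_biproduct C X Y S)"

definition is_coproduct ::
    "('r, 'o, 'm, 'z) lin_cat_scheme \<Rightarrow> 'i set \<Rightarrow> ('i \<Rightarrow> 'o) \<Rightarrow> 'o \<Rightarrow> ('i \<Rightarrow> 'm) \<Rightarrow> bool" where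
  "is_coproduct C I F S \<iota> \<longleftrightarrow> F \<in> I \<rightarrow> Ob C \<and> S \<in> Ob C \<and> (\<forall>i\<in>I. \<iota> i \<in> arrows C (F i) S) \<and>
     (\<forall>Y\<in>Ob C. \<forall>f. (\<forall>i\<in>I. f i \<in> arrows C (F i) Y) \<longrightarrow>
        (\<exists>!h. h \<in> arrows C S Y \<and> (\<forall>i\<in>I. h \<cdot>\<^bsub>C\<^esub> \<iota> i = f i)))"

text \<open>
  Every \<open>\<kappa>\<close>-small set is in bijection with a \<open>\<kappa>\<close>-small subset of the field of \<open>\<kappa>\<close>, so index sets
  in the type underlying \<open>\<kappa>\<close> suffice.
\<close>

definition has_coproducts :: "'u rel \<Rightarrow> ('r, 'o, 'm, 'z) lin_cat_scheme \<Rightarrow> bool" where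
  "has_coproducts \<kappa> C \<longleftrightarrow>
     (\<forall>(I :: 'u set) F. small \<kappa> I \<longrightarrow> F \<in> I \<rightarrow> Ob C \<longrightarrow> (\<exists>S \<iota>. is_coproduct C I F S \<iota>))"

section \<open>Linear functors\<close>

record ('o, 'm, 'p, 'n) functor_data =
  on_ob :: "'o \<Rightarrow> 'p"
  on_ar :: "'m \<Rightarrow> 'n"

definition linear_functor ::
    "('r, 's) ring_scheme \<Rightarrow> ('r, 'o, 'm, 'z) lin_cat_scheme \<Rightarrow> ('r, 'p, 'n, 'y) lin_cat_scheme \<Rightarrow>
     ('o, 'm, 'p, 'n) functor_data \<Rightarrow> bool" where
  "linear_functor R C D F \<longleftrightarrow>
     (\<forall>X\<in>Ob C. on_ob F X \<in> Ob D) \<and>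
     (\<forall>X\<in>Ob C. \<forall>Y\<in>Ob C.
        on_ar F \<in> linear_maps R (Hom C X Y) (Hom D (on_ob F X) (on_ob F Y))) \<and>
     (\<forall>X\<in>Ob C. on_ar F (ident C X) = ident D (on_ob F X)) \<and>
     (\<forall>X\<in>Ob C. \<forall>Y\<in>Ob C. \<forall>Z\<in>Ob C. \<forall>f\<in>arrows C X Y. \<forall>g\<in>arrows C Y Z.
        on_ar F (g \<cdot>\<^bsub>C\<^esub> f) = on_ar F g \<cdot>\<^bsub>D\<^esub> on_ar F f)"

definition id_functor :: "('o, 'm, 'o, 'm) functor_data" where
  "id_functor = \<lparr>on_ob = id, on_ar = id\<rparr>"

definition comp_functor ::
    "('p, 'n, 'q, 'l) functor_data \<Rightarrow> ('o, 'm, 'p, 'n) functor_data \<Rightarrow> ('o, 'm, 'q, 'l) functor_data"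
  where
  "comp_functor G F = \<lparr>on_ob = on_ob G \<circ> on_ob F, on_ar = on_ar G \<circ> on_ar F\<rparr>"

definition naturally_isomorphic ::
    "('r, 'o, 'm, 'z) lin_cat_scheme \<Rightarrow> ('r, 'p, 'n, 'y) lin_cat_scheme \<Rightarrow>
     ('o, 'm, 'p, 'n) functor_data \<Rightarrow> ('o, 'm, 'p, 'n) functor_data \<Rightarrow> bool" where
  "naturally_isomorphic C D F G \<longleftrightarrow>
     (\<exists>\<eta>. (\<forall>X\<in>Ob C. is_iso D (on_ob F X) (on_ob G X) (\<eta> X)) \<and>
          (\<forall>X\<in>Ob C. \<forall>Y\<in>Ob C. \<forall>f\<in>arrows C X Y. \<eta> Y \<cdot>\<^bsub>D\<^esub> on_ar F f = on_ar G f \<cdot>\<^bsub>D\<^esub> \<eta> X))"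

definition quasi_inverse_equivalences ::
    "('r, 's) ring_scheme \<Rightarrow> ('r, 'o, 'm, 'z) lin_cat_scheme \<Rightarrow> ('r, 'p, 'n, 'y) lin_cat_scheme \<Rightarrow>
     ('o, 'm, 'p, 'n) functor_data \<Rightarrow> ('p, 'n, 'o, 'm) functor_data \<Rightarrow> bool" where
  "quasi_inverse_equivalences R C D F G \<longleftrightarrow>
     linear_functor R C D F \<and> linear_functor R D C G \<and>
     naturally_isomorphic C C id_functor (comp_functor G F) \<and>
     naturally_isomorphic D D (comp_functor F G) id_functor"

section \<open>Linear triangulated categories\<close>

text \<open>
  \<open>Tri D X Y Z f g h\<close> says that \<open>X \<rightarrow> Y \<rightarrow> Z \<rightarrow> X[1]\<close>, with maps \<open>f\<close>, \<open>g\<close>, \<open>h\<close>, is one of the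
  distinguished triangles.  The functors \<open>susp\<close> and \<open>desusp\<close> are \<open>[1]\<close> and \<open>[-1]\<close>; they are only
  required to be mutually quasi-inverse, which includes the case of an automorphism \<open>[1]\<close>.
\<close>

record ('r, 'o, 'm) tri_cat = "('r, 'o, 'm) lin_cat" +
  susp :: "('o, 'm, 'o, 'm) functor_data"
  desusp :: "('o, 'm, 'o, 'm) functor_data"
  Tri :: "'o \<Rightarrow> 'o \<Rightarrow> 'o \<Rightarrow> 'm \<Rightarrow> 'm \<Rightarrow> 'm \<Rightarrow> bool"

abbreviation sh_ob :: "('r, 'o, 'm, 'z) tri_cat_scheme \<Rightarrow> 'o \<Rightarrow> 'o" where
  "sh_ob D X \<equiv> on_ob (susp D) X"

abbreviation sh_ar :: "('r, 'o, 'm, 'z) tri_cat_scheme \<Rightarrow> 'm \<Rightarrow> 'm" where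
  "sh_ar D f \<equiv> on_ar (susp D) f"

definition candidate_triangle ::
    "('r, 'o, 'm, 'z) tri_cat_scheme \<Rightarrow> 'o \<Rightarrow> 'o \<Rightarrow> 'o \<Rightarrow> 'm \<Rightarrow> 'm \<Rightarrow> 'm \<Rightarrow> bool" where
  "candidate_triangle D X Y Z f g h \<longleftrightarrow> X \<in> Ob D \<and> Y \<in> Ob D \<and> Z \<in> Ob D \<and>
     f \<in> arrows D X Y \<and> g \<in> arrows D Y Z \<and> h \<in> arrows D Z (sh_ob D X)"

locale linear_triangulated_category = linear_category R D
  for R :: "('r, 's) ring_scheme"
    and D :: "('r, 'o, 'm, 'z) tri_cat_scheme" +
  assumes zero_object: "\<exists>Z. is_zero_object D Z"
    and biproducts: "\<lbrakk>X \<in> Ob D; Y \<in> Ob D\<rbrakk> \<Longrightarrow> \<exists>S. is_biproduct D X Y S"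
    and shift_equivalence: "quasi_inverse_equivalences R D D (susp D) (desusp D)"
    and Tri_candidate: "Tri D X Y Z f g h \<Longrightarrow> candidate_triangle D X Y Z f g h"
    and Tri_iso_closed: "\<lbrakk>Tri D X Y Z f g h; candidate_triangle D X' Y' Z' f' g' h';
      is_iso D X X' a; is_iso D Y Y' b; is_iso D Z Z' c;
      b \<cdot>\<^bsub>D\<^esub> f = f' \<cdot>\<^bsub>D\<^esub> a; c \<cdot>\<^bsub>D\<^esub> g = g' \<cdot>\<^bsub>D\<^esub> b; sh_ar D a \<cdot>\<^bsub>D\<^esub> h = h' \<cdot>\<^bsub>D\<^esub> c\<rbrakk>
      \<Longrightarrow> Tri D X' Y' Z' f' g' h'"
    and Tri_ident: "\<lbrakk>X \<in> Ob D; is_zero_object D Z\<rbrakk>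
      \<Longrightarrow> Tri D X X Z (ident D X) \<zero>\<^bsub>Hom D X Z\<^esub> \<zero>\<^bsub>Hom D Z (sh_ob D X)\<^esub>"
    and Tri_cone: "\<lbrakk>X \<in> Ob D; Y \<in> Ob D; f \<in> arrows D X Y\<rbrakk> \<Longrightarrow> \<exists>Z g h. Tri D X Y Z f g h"
    and Tri_rotate: "candidate_triangle D X Y Z f g h \<Longrightarrow>
      Tri D X Y Z f g h \<longleftrightarrow>
      Tri D Y Z (sh_ob D X) g h (\<ominus>\<^bsub>Hom D (sh_ob D X) (sh_ob D Y)\<^esub> sh_ar D f)"
    and Tri_morphism: "\<lbrakk>Tri D X Y Z f g h; Tri D X' Y' Z' f' g' h';
      a \<in> arrows D X X'; b \<in> arrows D Y Y'; b \<cdot>\<^bsub>D\<^esub> f = f' \<cdot>\<^bsub>D\<^esub> a\<rbrakk>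
      \<Longrightarrow> \<exists>c\<in>arrows D Z Z'. c \<cdot>\<^bsub>D\<^esub> g = g' \<cdot>\<^bsub>D\<^esub> b \<and> sh_ar D a \<cdot>\<^bsub>D\<^esub> h = h' \<cdot>\<^bsub>D\<^esub> c"
    and Tri_octahedron: "\<lbrakk>Tri D X Y U f a b; Tri D Y Z W g c d; Tri D X Z V (g \<cdot>\<^bsub>D\<^esub> f) e k\<rbrakk>
      \<Longrightarrow> \<exists>u v. Tri D U V W u v (sh_ar D a \<cdot>\<^bsub>D\<^esub> d) \<and>
            u \<cdot>\<^bsub>D\<^esub> a = e \<cdot>\<^bsub>D\<^esub> g \<and> k \<cdot>\<^bsub>D\<^esub> u = b \<and>
            v \<cdot>\<^bsub>D\<^esub> e = c \<and> d \<cdot>\<^bsub>D\<^esub> v = sh_ar D f \<cdot>\<^bsub>D\<^esub> k"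

definition shift :: "('r, 'o, 'm, 'z) tri_cat_scheme \<Rightarrow> 'o \<Rightarrow> int \<Rightarrow> 'o" where
  "shift D X n = (if 0 \<le> n then (on_ob (susp D) ^^ nat n) X else (on_ob (desusp D) ^^ nat (- n)) X)"

definition shifts :: "('r, 'o, 'm, 'z) tri_cat_scheme \<Rightarrow> 'o set \<Rightarrow> 'o set" where
  "shifts D G = {shift D X n | X n. X \<in> G}"

definition Add :: "'u rel \<Rightarrow> ('r, 'o, 'm, 'z) lin_cat_scheme \<Rightarrow> 'o set \<Rightarrow> 'o set" where
  "Add \<kappa> C A = {Y \<in> Ob C. \<exists>(I :: 'u set) F S \<iota>. small \<kappa> I \<and> F \<in> I \<rightarrow> A \<and>
     is_coproduct C I F S \<iota> \<and> direct_summand C Y S}"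

definition smd :: "('r, 'o, 'm, 'z) lin_cat_scheme \<Rightarrow> 'o set \<Rightarrow> 'o set" where
  "smd C A = {Y \<in> Ob C. \<exists>S\<in>A. direct_summand C Y S}"

definition star :: "('r, 'o, 'm, 'z) tri_cat_scheme \<Rightarrow> 'o set \<Rightarrow> 'o set \<Rightarrow> 'o set" where
  "star D A B = {Y \<in> Ob D. \<exists>X\<in>A. \<exists>Z\<in>B. \<exists>f g h. Tri D X Y Z f g h}"

text \<open>Only exponents \<open>n \<ge> 1\<close> are meaningful; the value at \<open>0\<close> is a dummy.\<close>

fun star_power :: "('r, 'o, 'm, 'z) tri_cat_scheme \<Rightarrow> 'o set \<Rightarrow> nat \<Rightarrow> 'o set" where
  "star_power D A 0 = {}"
| "star_power D A (Suc 0) = smd D A"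
| "star_power D A (Suc (Suc n)) = smd D (star D (star_power D A (Suc n)) (star_power D A (Suc 0)))"

section \<open>Contravariant functors to modules\<close>

type_synonym ('r, 'o, 'm, 'x) module_functor = "('o, 'm, ('r, 'x) module, 'x \<Rightarrow> 'x) functor_data"

text \<open>
  A contravariant linear functor to the category of (\<open>\<kappa>\<close>-small) \<open>R\<close>-modules.  Morphisms of modules
  are functions that matter only on the carrier.
\<close>

definition contravariant_functor ::
    "'u rel \<Rightarrow> ('r, 's) ring_scheme \<Rightarrow> ('r, 'o, 'm, 'z) lin_cat_scheme \<Rightarrow>
     ('r, 'o, 'm, 'x) module_functor \<Rightarrow> bool" where
  "contravariant_functor \<kappa> R C M \<longleftrightarrow>
     (\<forall>X\<in>Ob C. module R (on_ob M X) \<and> small \<kappa> (carrier (on_ob M X))) \<and>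
     (\<forall>X\<in>Ob C. \<forall>Y\<in>Ob C. \<forall>f\<in>arrows C X Y. on_ar M f \<in> linear_maps R (on_ob M Y) (on_ob M X)) \<and>
     (\<forall>X\<in>Ob C. \<forall>x\<in>carrier (on_ob M X). on_ar M (ident C X) x = x) \<and>
     (\<forall>X\<in>Ob C. \<forall>Y\<in>Ob C. \<forall>Z\<in>Ob C. \<forall>f\<in>arrows C X Y. \<forall>g\<in>arrows C Y Z.
        \<forall>x\<in>carrier (on_ob M Z). on_ar M (g \<cdot>\<^bsub>C\<^esub> f) x = on_ar M f (on_ar M g x)) \<and>
     (\<forall>X\<in>Ob C. \<forall>Y\<in>Ob C. \<forall>f\<in>arrows C X Y. \<forall>g\<in>arrows C X Y. \<forall>x\<in>carrier (on_ob M Y).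
        on_ar M (f \<oplus>\<^bsub>Hom C X Y\<^esub> g) x = on_ar M f x \<oplus>\<^bsub>on_ob M X\<^esub> on_ar M g x) \<and>
     (\<forall>X\<in>Ob C. \<forall>Y\<in>Ob C. \<forall>a\<in>carrier R. \<forall>f\<in>arrows C X Y. \<forall>x\<in>carrier (on_ob M Y).
        on_ar M (a \<odot>\<^bsub>Hom C X Y\<^esub> f) x = a \<odot>\<^bsub>on_ob M X\<^esub> on_ar M f x)"

definition contra_naturally_isomorphic ::
    "('r, 's) ring_scheme \<Rightarrow> ('r, 'o, 'm, 'z) lin_cat_scheme \<Rightarrow>
     ('r, 'o, 'm, 'x) module_functor \<Rightarrow> ('r, 'o, 'm, 'y) module_functor \<Rightarrow> bool" where
  "contra_naturally_isomorphic R C M N \<longleftrightarrow>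
     (\<exists>\<phi>. (\<forall>X\<in>Ob C. \<phi> X \<in> linear_maps R (on_ob M X) (on_ob N X) \<and>
             bij_betw (\<phi> X) (carrier (on_ob M X)) (carrier (on_ob N X))) \<and>
          (\<forall>X\<in>Ob C. \<forall>Y\<in>Ob C. \<forall>f\<in>arrows C X Y. \<forall>x\<in>carrier (on_ob M Y).
             \<phi> X (on_ar M f x) = on_ar N f (\<phi> Y x)))"

definition hom_into :: "('r, 'o, 'm, 'z) lin_cat_scheme \<Rightarrow> 'o \<Rightarrow> ('r, 'o, 'm, 'm) module_functor" where
  "hom_into C X = \<lparr>on_ob = (\<lambda>Y. Hom C Y X), on_ar = (\<lambda>f g. g \<cdot>\<^bsub>C\<^esub> f)\<rparr>"

definition representable ::
    "('r, 's) ring_scheme \<Rightarrow> ('r, 'o, 'm, 'z) lin_cat_scheme \<Rightarrow>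
     ('r, 'o, 'm, 'x) module_functor \<Rightarrow> bool" where
  "representable R C M \<longleftrightarrow> (\<exists>X\<in>Ob C. contra_naturally_isomorphic R C M (hom_into C X))"

definition cohomological ::
    "('r, 'o, 'm, 'z) tri_cat_scheme \<Rightarrow> ('r, 'o, 'm, 'x) module_functor \<Rightarrow> bool" where
  "cohomological D M \<longleftrightarrow> (\<forall>X Y Z f g h. Tri D X Y Z f g h \<longrightarrow>
     on_ar M g ` carrier (on_ob M Z) = {y \<in> carrier (on_ob M Y). on_ar M f y = \<zero>\<^bsub>on_ob M X\<^esub>})"

text \<open>
  The canonical map from the value at a coproduct to the product of the values is an isomorphism;
  it is linear for the componentwise module structure, so this means that it is bijective.
\<close>

definition coproducts_to_products ::
    "'u rel \<Rightarrow> ('r, 'o, 'm, 'z) lin_cat_scheme \<Rightarrow> ('r, 'o, 'm, 'x) module_functor \<Rightarrow> bool" where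
  "coproducts_to_products \<kappa> C M \<longleftrightarrow>
     (\<forall>(I :: 'u set) F S \<iota>. small \<kappa> I \<longrightarrow> is_coproduct C I F S \<iota> \<longrightarrow>
        bij_betw (\<lambda>x. \<lambda>i\<in>I. on_ar M (\<iota> i) x) (carrier (on_ob M S))
          (\<Pi>\<^sub>E i\<in>I. carrier (on_ob M (F i))))"

end

theory Submission
  imports Defs
begin

text \<open>
  A representable functor is cohomological because \<open>Hom(-, W)\<close> is exact on triangles, and it turns
  coproducts into products by their universal property.

  Conversely, let \<open>M\<close> be cohomological and send coproducts to products, and let \<open>S\<close> be
  the set of shifts of \<open>G\<close>. An element \<open>x\<close> of \<open>M X\<close> is the same as a
  natural transformation from \<open>Hom(-, X)\<close> to \<open>M\<close>. Brown's construction starts from an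
  \<open>x\<close> that is surjective on (the suspension of) \<open>S\<close> (\<open>exists_cover\<close>) and
  attaches cones: the map \<open>t : X \<rightarrow> X'\<close> into the cone kills all maps from \<open>S\<close>
  to \<open>X\<close> on which \<open>x\<close> vanishes, and \<open>x\<close> extends along \<open>t\<close> to
  an element of \<open>M X'\<close> (\<open>exists_kill\<close>). Surjectivity on \<open>S\<close> and killing on
  \<open>S\<close> are inherited by coproducts and direct summands, hence by \<open>Add S\<close>.

  The objects of \<open>G\<close> need not be compact, so maps out of them may fail to commute with the colimit of
  this process. Instead, finitely many steps suffice. A five lemma chase shows that with each further cone both
  properties pass from the outer terms of a triangle to the middle one (\<open>covers_extension\<close>,
  \<open>kills_extension\<close>). As \<open>n\<close> extensions exhaust the category, after finitely many cones
  there is an \<open>x\<close> that is surjective everywhere (\<open>star_power_cover\<close>), and after finitely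
  many more a map \<open>t : X \<rightarrow> X'\<close> that kills the whole kernel of \<open>Hom(-, X)
  \<rightarrow> M\<close> (\<open>star_power_kill\<close>). Then \<open>M\<close> is the image of \<open>t\<close>
  on \<open>Hom(-, X) \<rightarrow> Hom(-, X')\<close>, and it is a retract of \<open>Hom(-, X')\<close>.
  Idempotents split in a triangulated category with countable coproducts (\<open>idempotent_splits\<close>), so
  \<open>M\<close> is representable (\<open>representable_of_cover_and_kill\<close>).
\<close>

section \<open>Linear maps and linear categories\<close>

lemma linear_map_closed:
  "h \<in> linear_maps R M N \<Longrightarrow> x \<in> carrier M \<Longrightarrow> h x \<in> carrier N"
  by (auto simp: linear_maps_def)

lemma linear_map_add:
  "h \<in> linear_maps R M N \<Longrightarrow> x \<in> carrier M \<Longrightarrow> y \<in> carrier M \<Longrightarrow> h (x \<oplus>\<^bsub>M\<^esub> y) = h x \<oplus>\<^bsub>N\<^esub> h y"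
  by (auto simp: linear_maps_def)

lemma linear_map_smult:
  "h \<in> linear_maps R M N \<Longrightarrow> a \<in> carrier R \<Longrightarrow> x \<in> carrier M \<Longrightarrow> h (a \<odot>\<^bsub>M\<^esub> x) = a \<odot>\<^bsub>N\<^esub> h x"
  by (auto simp: linear_maps_def)

lemma linear_map_zero:
  assumes "module R M" "module R N" "h \<in> linear_maps R M N"
  shows "h \<zero>\<^bsub>M\<^esub> = \<zero>\<^bsub>N\<^esub>"
proof -
  interpret M: module R M by fact
  interpret N: module R N by fact
  have "h \<zero>\<^bsub>M\<^esub> \<oplus>\<^bsub>N\<^esub> h \<zero>\<^bsub>M\<^esub> = h \<zero>\<^bsub>M\<^esub>"
    using linear_map_add[OF assms(3), of "\<zero>\<^bsub>M\<^esub>" "\<zero>\<^bsub>M\<^esub>"] by simp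
  then show ?thesis
    using linear_map_closed[OF assms(3) M.M.zero_closed] by (simp add: N.M.add.l_cancel_one)
qed

lemma linear_map_a_inv:
  assumes "module R M" "module R N" "h \<in> linear_maps R M N" "x \<in> carrier M"
  shows "h (\<ominus>\<^bsub>M\<^esub> x) = \<ominus>\<^bsub>N\<^esub> h x"
proof -
  interpret M: module R M by fact
  interpret N: module R N by fact
  have "h (\<ominus>\<^bsub>M\<^esub> x) \<oplus>\<^bsub>N\<^esub> h x = \<zero>\<^bsub>N\<^esub>"
    using linear_map_add[OF assms(3), of "\<ominus>\<^bsub>M\<^esub> x" x] linear_map_zero[OF assms(1-3)] assms(4)
    by (simp add: M.M.l_neg)
  then show ?thesis
    using linear_map_closed[OF assms(3)] assms(4) by (metis N.M.minus_equality M.M.a_inv_closed)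
qed

lemma linear_map_minus:
  assumes "module R M" "module R N" "h \<in> linear_maps R M N" "x \<in> carrier M" "y \<in> carrier M"
  shows "h (x \<ominus>\<^bsub>M\<^esub> y) = h x \<ominus>\<^bsub>N\<^esub> h y"
proof -
  interpret M: module R M by fact
  interpret N: module R N by fact
  show ?thesis
    using linear_map_add[OF assms(3,4), of "\<ominus>\<^bsub>M\<^esub> y"] linear_map_a_inv[OF assms(1-3,5)] assms(5)
    by (simp add: M.M.minus_eq N.M.minus_eq)
qed

lemma module_minus_eq_zero_iff:
  assumes "module R M" "x \<in> carrier M" "y \<in> carrier M"
  shows "x \<ominus>\<^bsub>M\<^esub> y = \<zero>\<^bsub>M\<^esub> \<longleftrightarrow> x = y"
proof -
  interpret M: module R M by fact
  show ?thesis using assms(2,3)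
    by (metis M.M.minus_eq M.M.minus_equality M.M.r_neg M.M.a_inv_closed M.M.minus_minus M.M.a_comm)
qed

lemma
  assumes "module R M"
  shows module_zero_closed: "\<zero>\<^bsub>M\<^esub> \<in> carrier M"
    and module_add_closed: "x \<in> carrier M \<Longrightarrow> y \<in> carrier M \<Longrightarrow> x \<oplus>\<^bsub>M\<^esub> y \<in> carrier M"
    and module_a_inv_closed: "x \<in> carrier M \<Longrightarrow> \<ominus>\<^bsub>M\<^esub> x \<in> carrier M"
    and module_add_zero: "x \<in> carrier M \<Longrightarrow> x \<oplus>\<^bsub>M\<^esub> \<zero>\<^bsub>M\<^esub> = x"
    and module_zero_add: "x \<in> carrier M \<Longrightarrow> \<zero>\<^bsub>M\<^esub> \<oplus>\<^bsub>M\<^esub> x = x"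
    and module_a_inv_eq_zero: "x \<in> carrier M \<Longrightarrow> \<ominus>\<^bsub>M\<^esub> x = \<zero>\<^bsub>M\<^esub> \<Longrightarrow> x = \<zero>\<^bsub>M\<^esub>"
proof -
  interpret M: module R M by fact
  show "\<zero>\<^bsub>M\<^esub> \<in> carrier M"
    and "x \<in> carrier M \<Longrightarrow> y \<in> carrier M \<Longrightarrow> x \<oplus>\<^bsub>M\<^esub> y \<in> carrier M"
    and "x \<in> carrier M \<Longrightarrow> \<ominus>\<^bsub>M\<^esub> x \<in> carrier M"
    and "x \<in> carrier M \<Longrightarrow> x \<oplus>\<^bsub>M\<^esub> \<zero>\<^bsub>M\<^esub> = x"
    and "x \<in> carrier M \<Longrightarrow> \<zero>\<^bsub>M\<^esub> \<oplus>\<^bsub>M\<^esub> x = x"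
    by simp_all
  show "x \<in> carrier M \<Longrightarrow> \<ominus>\<^bsub>M\<^esub> x = \<zero>\<^bsub>M\<^esub> \<Longrightarrow> x = \<zero>\<^bsub>M\<^esub>"
    using M.M.r_neg M.M.r_zero by metis
qed

lemma module_minus_closed:
  assumes "module R M" "x \<in> carrier M" "y \<in> carrier M"
  shows "x \<ominus>\<^bsub>M\<^esub> y \<in> carrier M"
proof -
  interpret M: module R M by fact
  show ?thesis using assms(2,3) by simp
qed

lemma module_minus_add_cancel:
  assumes "module R M" "x \<in> carrier M" "y \<in> carrier M"
  shows "x \<oplus>\<^bsub>M\<^esub> (y \<ominus>\<^bsub>M\<^esub> x) = y"
proof -
  interpret M: module R M by fact
  show ?thesis using assms(2,3)
    by (metis M.M.minus_eq M.M.a_inv_closed M.M.a_comm M.M.a_assoc M.M.l_neg M.M.r_zero)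
qed

context linear_category
begin

lemma cmp_closed:
  "\<lbrakk>X \<in> Ob C; Y \<in> Ob C; Z \<in> Ob C; f \<in> arrows C X Y; g \<in> arrows C Y Z\<rbrakk> \<Longrightarrow> g \<cdot>\<^bsub>C\<^esub> f \<in> arrows C X Z"
  using linear_map_closed[OF cmp_linear_right] by blast

lemma zero_arrow: "\<lbrakk>X \<in> Ob C; Y \<in> Ob C\<rbrakk> \<Longrightarrow> \<zero>\<^bsub>Hom C X Y\<^esub> \<in> arrows C X Y"
  using module_zero_closed[OF Hom_module] by blast

lemma add_arrow:
  "\<lbrakk>X \<in> Ob C; Y \<in> Ob C; f \<in> arrows C X Y; g \<in> arrows C X Y\<rbrakk> \<Longrightarrow> f \<oplus>\<^bsub>Hom C X Y\<^esub> g \<in> arrows C X Y"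
  using module_add_closed[OF Hom_module] by blast

lemma minus_arrow:
  "\<lbrakk>X \<in> Ob C; Y \<in> Ob C; f \<in> arrows C X Y; g \<in> arrows C X Y\<rbrakk> \<Longrightarrow> f \<ominus>\<^bsub>Hom C X Y\<^esub> g \<in> arrows C X Y"
  using module_minus_closed[OF Hom_module] by blast

lemma a_inv_arrow:
  "\<lbrakk>X \<in> Ob C; Y \<in> Ob C; f \<in> arrows C X Y\<rbrakk> \<Longrightarrow> \<ominus>\<^bsub>Hom C X Y\<^esub> f \<in> arrows C X Y"
  using module_a_inv_closed[OF Hom_module] by blast

lemma add_zero_arrow:
  "\<lbrakk>X \<in> Ob C; Y \<in> Ob C; f \<in> arrows C X Y\<rbrakk> \<Longrightarrow> f \<oplus>\<^bsub>Hom C X Y\<^esub> \<zero>\<^bsub>Hom C X Y\<^esub> = f"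
  using module_add_zero[OF Hom_module] by blast

lemma zero_add_arrow:
  "\<lbrakk>X \<in> Ob C; Y \<in> Ob C; f \<in> arrows C X Y\<rbrakk> \<Longrightarrow> \<zero>\<^bsub>Hom C X Y\<^esub> \<oplus>\<^bsub>Hom C X Y\<^esub> f = f"
  using module_zero_add[OF Hom_module] by blast

lemma cmp_zero_right:
  "\<lbrakk>X \<in> Ob C; Y \<in> Ob C; Z \<in> Ob C; g \<in> arrows C Y Z\<rbrakk> \<Longrightarrow> g \<cdot>\<^bsub>C\<^esub> \<zero>\<^bsub>Hom C X Y\<^esub> = \<zero>\<^bsub>Hom C X Z\<^esub>"
  using linear_map_zero[OF _ _ cmp_linear_right] Hom_module by blast

lemma cmp_zero_left:
  "\<lbrakk>X \<in> Ob C; Y \<in> Ob C; Z \<in> Ob C; f \<in> arrows C X Y\<rbrakk> \<Longrightarrow> \<zero>\<^bsub>Hom C Y Z\<^esub> \<cdot>\<^bsub>C\<^esub> f = \<zero>\<^bsub>Hom C X Z\<^esub>"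
  using linear_map_zero[OF _ _ cmp_linear_left] Hom_module by blast

lemma cmp_add_right:
  "\<lbrakk>X \<in> Ob C; Y \<in> Ob C; Z \<in> Ob C; g \<in> arrows C Y Z; f \<in> arrows C X Y; f' \<in> arrows C X Y\<rbrakk>
   \<Longrightarrow> g \<cdot>\<^bsub>C\<^esub> (f \<oplus>\<^bsub>Hom C X Y\<^esub> f') = (g \<cdot>\<^bsub>C\<^esub> f) \<oplus>\<^bsub>Hom C X Z\<^esub> (g \<cdot>\<^bsub>C\<^esub> f')"
  using linear_map_add[OF cmp_linear_right] by blast

lemma cmp_add_left:
  "\<lbrakk>X \<in> Ob C; Y \<in> Ob C; Z \<in> Ob C; f \<in> arrows C X Y; g \<in> arrows C Y Z; g' \<in> arrows C Y Z\<rbrakk>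
   \<Longrightarrow> (g \<oplus>\<^bsub>Hom C Y Z\<^esub> g') \<cdot>\<^bsub>C\<^esub> f = (g \<cdot>\<^bsub>C\<^esub> f) \<oplus>\<^bsub>Hom C X Z\<^esub> (g' \<cdot>\<^bsub>C\<^esub> f)"
  using linear_map_add[OF cmp_linear_left] by blast

lemma cmp_minus_right:
  "\<lbrakk>X \<in> Ob C; Y \<in> Ob C; Z \<in> Ob C; g \<in> arrows C Y Z; f \<in> arrows C X Y; f' \<in> arrows C X Y\<rbrakk>
   \<Longrightarrow> g \<cdot>\<^bsub>C\<^esub> (f \<ominus>\<^bsub>Hom C X Y\<^esub> f') = (g \<cdot>\<^bsub>C\<^esub> f) \<ominus>\<^bsub>Hom C X Z\<^esub> (g \<cdot>\<^bsub>C\<^esub> f')"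
  using linear_map_minus[OF _ _ cmp_linear_right] Hom_module by blast

lemma cmp_minus_left:
  "\<lbrakk>X \<in> Ob C; Y \<in> Ob C; Z \<in> Ob C; f \<in> arrows C X Y; g \<in> arrows C Y Z; g' \<in> arrows C Y Z\<rbrakk>
   \<Longrightarrow> (g \<ominus>\<^bsub>Hom C Y Z\<^esub> g') \<cdot>\<^bsub>C\<^esub> f = (g \<cdot>\<^bsub>C\<^esub> f) \<ominus>\<^bsub>Hom C X Z\<^esub> (g' \<cdot>\<^bsub>C\<^esub> f)"
  using linear_map_minus[OF _ _ cmp_linear_left] Hom_module by blast

lemma cmp_a_inv_left:
  "\<lbrakk>X \<in> Ob C; Y \<in> Ob C; Z \<in> Ob C; f \<in> arrows C X Y; g \<in> arrows C Y Z\<rbrakk>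
   \<Longrightarrow> (\<ominus>\<^bsub>Hom C Y Z\<^esub> g) \<cdot>\<^bsub>C\<^esub> f = \<ominus>\<^bsub>Hom C X Z\<^esub> (g \<cdot>\<^bsub>C\<^esub> f)"
  using linear_map_a_inv[OF _ _ cmp_linear_left] Hom_module by blast

lemma a_inv_arrow_eq_zero:
  assumes "X \<in> Ob C" "Y \<in> Ob C" "f \<in> arrows C X Y" "\<ominus>\<^bsub>Hom C X Y\<^esub> f = \<zero>\<^bsub>Hom C X Y\<^esub>"
  shows "f = \<zero>\<^bsub>Hom C X Y\<^esub>"
  using module_a_inv_eq_zero[OF Hom_module] assms by blast

lemma minus_arrow_eq_zero_iff:
  "\<lbrakk>X \<in> Ob C; Y \<in> Ob C; f \<in> arrows C X Y; g \<in> arrows C X Y\<rbrakk>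
   \<Longrightarrow> f \<ominus>\<^bsub>Hom C X Y\<^esub> g = \<zero>\<^bsub>Hom C X Y\<^esub> \<longleftrightarrow> f = g"
  using module_minus_eq_zero_iff[OF Hom_module] by blast

lemma coproduct_ext:
  assumes "is_coproduct C I F S \<iota>" "Y \<in> Ob C" "f \<in> arrows C S Y" "g \<in> arrows C S Y"
    and "\<And>i. i \<in> I \<Longrightarrow> f \<cdot>\<^bsub>C\<^esub> \<iota> i = g \<cdot>\<^bsub>C\<^esub> \<iota> i"
  shows "f = g"
proof -
  have U: "\<forall>Y\<in>Ob C. \<forall>f. (\<forall>i\<in>I. f i \<in> arrows C (F i) Y) \<longrightarrow>
      (\<exists>!h. h \<in> arrows C S Y \<and> (\<forall>i\<in>I. h \<cdot>\<^bsub>C\<^esub> \<iota> i = f i))"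
    using assms(1) unfolding is_coproduct_def by blast
  have S: "S \<in> Ob C" and F: "\<And>i. i \<in> I \<Longrightarrow> F i \<in> Ob C"
    and \<iota>: "\<And>i. i \<in> I \<Longrightarrow> \<iota> i \<in> arrows C (F i) S"
    using assms(1) by (auto simp: is_coproduct_def)
  have "\<forall>i\<in>I. g \<cdot>\<^bsub>C\<^esub> \<iota> i \<in> arrows C (F i) Y"
    using cmp_closed F S \<iota> assms(2,4) by blast
  then have "\<exists>!h. h \<in> arrows C S Y \<and> (\<forall>i\<in>I. h \<cdot>\<^bsub>C\<^esub> \<iota> i = g \<cdot>\<^bsub>C\<^esub> \<iota> i)"
    by (rule U[THEN bspec, OF assms(2), THEN spec, THEN mp])
  then show ?thesis using assms(3-5) by blast
qed

lemma coproduct_map: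
  assumes "is_coproduct C I F S \<iota>" "Y \<in> Ob C" "\<And>i. i \<in> I \<Longrightarrow> f i \<in> arrows C (F i) Y"
  obtains h where "h \<in> arrows C S Y" "\<And>i. i \<in> I \<Longrightarrow> h \<cdot>\<^bsub>C\<^esub> \<iota> i = f i"
proof -
  have "\<forall>Y\<in>Ob C. \<forall>f. (\<forall>i\<in>I. f i \<in> arrows C (F i) Y) \<longrightarrow>
      (\<exists>!h. h \<in> arrows C S Y \<and> (\<forall>i\<in>I. h \<cdot>\<^bsub>C\<^esub> \<iota> i = f i))"
    using assms(1) unfolding is_coproduct_def by blast
  then have "\<exists>!h. h \<in> arrows C S Y \<and> (\<forall>i\<in>I. h \<cdot>\<^bsub>C\<^esub> \<iota> i = f i)"
    using assms(2,3) by blast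
  then show thesis using that by blast
qed

lemma direct_summand_retract:
  assumes "direct_summand C X S"
  obtains i p where "X \<in> Ob C" "S \<in> Ob C" "i \<in> arrows C X S" "p \<in> arrows C S X" "p \<cdot>\<^bsub>C\<^esub> i = ident C X"
proof -
  obtain Y where b: "is_biproduct C X Y S"
    using assms by (auto simp: direct_summand_def)
  then have "\<exists>i\<in>arrows C X S. \<exists>p\<in>arrows C S X. p \<cdot>\<^bsub>C\<^esub> i = ident C X"
    unfolding is_biproduct_def by meson
  then obtain i p where "i \<in> arrows C X S" "p \<in> arrows C S X" "p \<cdot>\<^bsub>C\<^esub> i = ident C X"
    by blast
  moreover have "X \<in> Ob C" "S \<in> Ob C"
    using b unfolding is_biproduct_def by blast+
  ultimately show thesis using that by blast
qed

end

section \<open>Triangles and exactness of representable functors\<close>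

context linear_triangulated_category
begin

lemma TriD:
  assumes "Tri D X Y Z f g h"
  shows "X \<in> Ob D" "Y \<in> Ob D" "Z \<in> Ob D" "f \<in> arrows D X Y" "g \<in> arrows D Y Z"
    "h \<in> arrows D Z (sh_ob D X)"
  using Tri_candidate[OF assms] by (auto simp: candidate_triangle_def)

lemma susp_functor: "linear_functor R D D (susp D)"
  and desusp_functor: "linear_functor R D D (desusp D)"
  using shift_equivalence by (auto simp: quasi_inverse_equivalences_def)

lemma
  assumes F: "linear_functor R D D F"
  shows functor_ob: "X \<in> Ob D \<Longrightarrow> on_ob F X \<in> Ob D"
    and functor_ar: "X \<in> Ob D \<Longrightarrow> Y \<in> Ob D \<Longrightarrow> f \<in> arrows D X Y
      \<Longrightarrow> on_ar F f \<in> arrows D (on_ob F X) (on_ob F Y)"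
    and functor_ident: "X \<in> Ob D \<Longrightarrow> on_ar F (ident D X) = ident D (on_ob F X)"
    and functor_cmp: "X \<in> Ob D \<Longrightarrow> Y \<in> Ob D \<Longrightarrow> Z \<in> Ob D \<Longrightarrow> f \<in> arrows D X Y \<Longrightarrow> g \<in> arrows D Y Z
      \<Longrightarrow> on_ar F (g \<cdot>\<^bsub>D\<^esub> f) = on_ar F g \<cdot>\<^bsub>D\<^esub> on_ar F f"
    and functor_zero: "X \<in> Ob D \<Longrightarrow> Y \<in> Ob D
      \<Longrightarrow> on_ar F \<zero>\<^bsub>Hom D X Y\<^esub> = \<zero>\<^bsub>Hom D (on_ob F X) (on_ob F Y)\<^esub>"
proof -
  show ob: "on_ob F X \<in> Ob D" if "X \<in> Ob D" for X
    using F that by (auto simp: linear_functor_def)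
  have lin: "on_ar F \<in> linear_maps R (Hom D X Y) (Hom D (on_ob F X) (on_ob F Y))"
    if "X \<in> Ob D" "Y \<in> Ob D" for X Y
    using F that by (auto simp: linear_functor_def)
  show "X \<in> Ob D \<Longrightarrow> Y \<in> Ob D \<Longrightarrow> f \<in> arrows D X Y
      \<Longrightarrow> on_ar F f \<in> arrows D (on_ob F X) (on_ob F Y)"
    by (rule linear_map_closed[OF lin])
  show "X \<in> Ob D \<Longrightarrow> Y \<in> Ob D
      \<Longrightarrow> on_ar F \<zero>\<^bsub>Hom D X Y\<^esub> = \<zero>\<^bsub>Hom D (on_ob F X) (on_ob F Y)\<^esub>"
    by (intro linear_map_zero[OF Hom_module Hom_module lin] ob)
qed (use F in \<open>auto simp: linear_functor_def\<close>)

lemmas sh_ob_closed = functor_ob[OF susp_functor]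
lemmas sh_ar_closed = functor_ar[OF susp_functor]
lemmas sh_ar_ident = functor_ident[OF susp_functor]
lemmas sh_ar_cmp = functor_cmp[OF susp_functor]
lemmas sh_ar_zero = functor_zero[OF susp_functor]

lemma Tri_rotated:
  assumes "Tri D X Y Z f g h"
  shows "Tri D Y Z (sh_ob D X) g h (\<ominus>\<^bsub>Hom D (sh_ob D X) (sh_ob D Y)\<^esub> sh_ar D f)"
  using Tri_rotate[OF Tri_candidate[OF assms]] assms by blast

lemma zero_object_shift:
  assumes "is_zero_object D Z"
  shows "is_zero_object D (sh_ob D Z)"
proof -
  have Z: "Z \<in> Ob D" and sZ: "sh_ob D Z \<in> Ob D"
    using assms sh_ob_closed by (auto simp: is_zero_object_def)
  have "ident D Z = \<zero>\<^bsub>Hom D Z Z\<^esub>"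
    using assms Z ident_arrow[OF Z] zero_arrow[OF Z Z] unfolding is_zero_object_def by blast
  then have id: "ident D (sh_ob D Z) = \<zero>\<^bsub>Hom D (sh_ob D Z) (sh_ob D Z)\<^esub>"
    using sh_ar_ident[OF Z] sh_ar_zero[OF Z Z] by simp
  have "f = \<zero>\<^bsub>Hom D (sh_ob D Z) X\<^esub>" if "X \<in> Ob D" "f \<in> arrows D (sh_ob D Z) X" for X f
    using cmp_ident_right[OF sZ that] cmp_zero_right[OF sZ sZ that] id by simp
  moreover have "f = \<zero>\<^bsub>Hom D X (sh_ob D Z)\<^esub>" if "X \<in> Ob D" "f \<in> arrows D X (sh_ob D Z)" for X f
    using cmp_ident_left[OF that(1) sZ that(2)] cmp_zero_left[OF that(1) sZ sZ that(2)] id by simp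
  ultimately show ?thesis
    using sZ zero_arrow unfolding is_zero_object_def by blast
qed

lemma Tri_cmp_zero:
  assumes T: "Tri D X Y Z f g h"
  shows "g \<cdot>\<^bsub>D\<^esub> f = \<zero>\<^bsub>Hom D X Z\<^esub>"
proof -
  note d = TriD[OF T]
  obtain O' where O': "is_zero_object D O'" using zero_object by blast
  then have Ob: "O' \<in> Ob D" by (auto simp: is_zero_object_def)
  have "Tri D X X O' (ident D X) \<zero>\<^bsub>Hom D X O'\<^esub> \<zero>\<^bsub>Hom D O' (sh_ob D X)\<^esub>"
    using Tri_ident d O' by blast
  from Tri_morphism[OF this T ident_arrow[OF d(1)] d(4) refl]
  obtain c where "c \<in> arrows D O' Z" "c \<cdot>\<^bsub>D\<^esub> \<zero>\<^bsub>Hom D X O'\<^esub> = g \<cdot>\<^bsub>D\<^esub> f" by blast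
  then show ?thesis using cmp_zero_right[OF d(1) Ob d(3)] by simp
qed

text \<open>
  Only the triangle \<open>X \<rightarrow> X \<rightarrow> 0 \<rightarrow> X[1]\<close> comes for free.  Rotating \<open>0 \<rightarrow> X \<rightarrow> X \<rightarrow> 0[1]\<close> once to the
  right gives it with \<open>0[1]\<close> in the place of \<open>0\<close>, since \<open>0[1]\<close> is again a zero object.
\<close>
lemma Tri_zero_ident:
  assumes Z: "is_zero_object D Z" and X: "X \<in> Ob D"
  shows "Tri D Z X X \<zero>\<^bsub>Hom D Z X\<^esub> (ident D X) \<zero>\<^bsub>Hom D X (sh_ob D Z)\<^esub>"
proof -
  have Zo: "Z \<in> Ob D" using Z by (auto simp: is_zero_object_def)
  note sZ = zero_object_shift[OF Z]
  have sZo: "sh_ob D Z \<in> Ob D" and sX: "sh_ob D X \<in> Ob D"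
    using sh_ob_closed Zo X by auto
  have uniq: "a = b" if "a \<in> arrows D (sh_ob D Z) (sh_ob D X)" "b \<in> arrows D (sh_ob D Z) (sh_ob D X)" for a b
    using sZ sX that unfolding is_zero_object_def by blast
  have "\<ominus>\<^bsub>Hom D (sh_ob D Z) (sh_ob D X)\<^esub> sh_ar D \<zero>\<^bsub>Hom D Z X\<^esub> = \<zero>\<^bsub>Hom D (sh_ob D Z) (sh_ob D X)\<^esub>"
    using uniq[OF a_inv_arrow[OF sZo sX sh_ar_closed[OF Zo X zero_arrow[OF Zo X]]] zero_arrow[OF sZo sX]] .
  moreover have "candidate_triangle D Z X X \<zero>\<^bsub>Hom D Z X\<^esub> (ident D X) \<zero>\<^bsub>Hom D X (sh_ob D Z)\<^esub>"
    using Zo X by (simp add: candidate_triangle_def zero_arrow ident_arrow sh_ob_closed)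
  ultimately show ?thesis
    using Tri_rotate Tri_ident[OF X sZ] by metis
qed

text \<open>
  This is the nontrivial half of the exactness of \<open>Hom(-, W)\<close>: a map with \<open>u \<cdot> f = 0\<close> is a
  commutative square from \<open>X \<rightarrow> Y \<rightarrow> Z\<close> to \<open>0 \<rightarrow> W \<rightarrow> W\<close>, and the third component of its completion to
  a morphism of triangles is the extension.
\<close>
lemma Tri_extend:
  assumes T: "Tri D X Y Z f g h" and W: "W \<in> Ob D" and u: "u \<in> arrows D Y W"
    and "u \<cdot>\<^bsub>D\<^esub> f = \<zero>\<^bsub>Hom D X W\<^esub>"
  obtains w where "w \<in> arrows D Z W" "w \<cdot>\<^bsub>D\<^esub> g = u"
proof -
  note d = TriD[OF T]
  obtain O' where O': "is_zero_object D O'" using zero_object by blast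
  then have Ob: "O' \<in> Ob D" by (auto simp: is_zero_object_def)
  note a = zero_arrow[OF d(1) Ob]
  have "u \<cdot>\<^bsub>D\<^esub> f = \<zero>\<^bsub>Hom D O' W\<^esub> \<cdot>\<^bsub>D\<^esub> \<zero>\<^bsub>Hom D X O'\<^esub>"
    using assms(4) cmp_zero_left[OF d(1) Ob W a] by simp
  from Tri_morphism[OF T Tri_zero_ident[OF O' W] a u this]
  obtain c where "c \<in> arrows D Z W" "c \<cdot>\<^bsub>D\<^esub> g = ident D W \<cdot>\<^bsub>D\<^esub> u" by blast
  then show thesis using that cmp_ident_left[OF d(2) W u] by simp
qed

section \<open>Splitting idempotents\<close>

text \<open>
  The complement of a split monomorphism \<open>s\<close> is its cone: the connecting map \<open>h\<close> satisfies
  \<open>s[1] \<cdot> h = 0\<close> and \<open>s[1]\<close> is a split monomorphism, so \<open>h = 0\<close>.  The idempotent \<open>q = 1 - s \<cdot> r\<close>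
  vanishes on \<open>s\<close> and therefore factors through the cone, which is how the section \<open>k\<close> arises.
\<close>
lemma split_mono_cokernel:
  assumes ob: "Y \<in> Ob D" and s: "s \<in> arrows D Y Y" and r: "r \<in> arrows D Y Y"
    and q: "q \<in> arrows D Y Y"
    and rs: "r \<cdot>\<^bsub>D\<^esub> s = ident D Y" and qs: "q \<cdot>\<^bsub>D\<^esub> s = \<zero>\<^bsub>Hom D Y Y\<^esub>"
    and sum: "q \<oplus>\<^bsub>Hom D Y Y\<^esub> (s \<cdot>\<^bsub>D\<^esub> r) = ident D Y"
  obtains Z g k where "Z \<in> Ob D" "g \<in> arrows D Y Z" "k \<in> arrows D Z Y"
    "k \<cdot>\<^bsub>D\<^esub> g = q" "g \<cdot>\<^bsub>D\<^esub> k = ident D Z"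
proof -
  obtain Z g h where T: "Tri D Y Y Z s g h" using Tri_cone ob s by blast
  note d = TriD[OF T]
  note Z = d(3) and g = d(5) and h = d(6)
  note T' = Tri_rotated[OF T]
  note sY = sh_ob_closed[OF ob] and ss = sh_ar_closed[OF ob ob s] and sr = sh_ar_closed[OF ob ob r]
  obtain k where k: "k \<in> arrows D Z Y" and kg: "k \<cdot>\<^bsub>D\<^esub> g = q"
    using Tri_extend[OF T ob q qs] by blast
  have gk: "g \<cdot>\<^bsub>D\<^esub> k \<in> arrows D Z Z" using cmp_closed[OF Z ob Z k g] .
  have "g \<cdot>\<^bsub>D\<^esub> (s \<cdot>\<^bsub>D\<^esub> r) = \<zero>\<^bsub>Hom D Y Z\<^esub>"
    using cmp_assoc[OF ob ob ob Z r s g] Tri_cmp_zero[OF T] cmp_zero_left[OF ob ob Z r] by simp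
  then have "g \<cdot>\<^bsub>D\<^esub> (q \<oplus>\<^bsub>Hom D Y Y\<^esub> (s \<cdot>\<^bsub>D\<^esub> r)) = g \<cdot>\<^bsub>D\<^esub> q"
    using cmp_add_right[OF ob ob Z g q cmp_closed[OF ob ob ob r s]]
      add_zero_arrow[OF ob Z cmp_closed[OF ob ob Z q g]] by simp
  then have "(g \<cdot>\<^bsub>D\<^esub> k) \<cdot>\<^bsub>D\<^esub> g = g"
    using sum kg cmp_ident_right[OF ob Z g] cmp_assoc[OF ob Z ob Z g k g] by simp
  then have "((g \<cdot>\<^bsub>D\<^esub> k) \<ominus>\<^bsub>Hom D Z Z\<^esub> ident D Z) \<cdot>\<^bsub>D\<^esub> g = \<zero>\<^bsub>Hom D Y Z\<^esub>"
    using cmp_minus_left[OF ob Z Z g gk ident_arrow[OF Z]] cmp_ident_left[OF ob Z g]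
      minus_arrow_eq_zero_iff[OF ob Z g g] by simp
  from Tri_extend[OF T' Z minus_arrow[OF Z Z gk ident_arrow[OF Z]] this]
  obtain w where w: "w \<in> arrows D (sh_ob D Y) Z"
    and wh: "w \<cdot>\<^bsub>D\<^esub> h = (g \<cdot>\<^bsub>D\<^esub> k) \<ominus>\<^bsub>Hom D Z Z\<^esub> ident D Z" by blast
  have "sh_ar D s \<cdot>\<^bsub>D\<^esub> h = \<zero>\<^bsub>Hom D Z (sh_ob D Y)\<^esub>"
    using Tri_cmp_zero[OF Tri_rotated[OF T']] cmp_a_inv_left[OF Z sY sY h ss]
      a_inv_arrow_eq_zero[OF Z sY cmp_closed[OF Z sY sY h ss]] by simp
  then have "(sh_ar D r \<cdot>\<^bsub>D\<^esub> sh_ar D s) \<cdot>\<^bsub>D\<^esub> h = \<zero>\<^bsub>Hom D Z (sh_ob D Y)\<^esub>"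
    using cmp_assoc[OF Z sY sY sY h ss sr] cmp_zero_right[OF Z sY sY sr] by simp
  moreover have "sh_ar D r \<cdot>\<^bsub>D\<^esub> sh_ar D s = ident D (sh_ob D Y)"
    using sh_ar_cmp[OF ob ob ob s r] rs sh_ar_ident[OF ob] by simp
  ultimately have "h = \<zero>\<^bsub>Hom D Z (sh_ob D Y)\<^esub>"
    using cmp_ident_left[OF Z sY h] by simp
  then have "g \<cdot>\<^bsub>D\<^esub> k = ident D Z"
    using wh cmp_zero_right[OF Z sY Z w] minus_arrow_eq_zero_iff[OF Z Z gk ident_arrow[OF Z]] by simp
  then show thesis using that Z g k kg by blast
qed

text \<open>
  An Eilenberg swindle.  Formally \<open>X = E + E'\<close> with \<open>E\<close> the image of \<open>e\<close>, so the coproduct \<open>Y\<close> of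
  countably many copies of \<open>X\<close> is isomorphic to \<open>E + Y\<close>, and \<open>E\<close> is the complement of a split
  monomorphism \<open>Y \<rightarrow> Y\<close>.  Concretely, \<open>s\<close> moves the \<open>E\<close>-part of each copy one place to the right and
  leaves the \<open>E'\<close>-parts alone; \<open>r\<close> moves the \<open>E\<close>-parts back and forgets the one in position \<open>0\<close>;
  and \<open>1 - s \<cdot> r = \<iota> 0 \<cdot> \<pi>\<close> is the projection onto the \<open>E\<close>-part in position \<open>0\<close>.
\<close>
lemma idempotent_splits:
  assumes X: "X \<in> Ob D" and e: "e \<in> arrows D X X" and ee: "e \<cdot>\<^bsub>D\<^esub> e = e"
    and cop: "is_coproduct D (UNIV :: nat set) (\<lambda>_. X) Y \<iota>"
  obtains Z p i where "Z \<in> Ob D" "p \<in> arrows D X Z" "i \<in> arrows D Z X"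
    "p \<cdot>\<^bsub>D\<^esub> i = ident D Z" "i \<cdot>\<^bsub>D\<^esub> p = e"
proof -
  have Y: "Y \<in> Ob D" and \<iota>: "\<iota> n \<in> arrows D X Y" for n
    using cop by (auto simp: is_coproduct_def)
  define d where "d = ident D X \<ominus>\<^bsub>Hom D X X\<^esub> e"
  note idX = ident_arrow[OF X]
  have d: "d \<in> arrows D X X"
    unfolding d_def by (rule minus_arrow[OF X X idX e])
  have ed: "e \<cdot>\<^bsub>D\<^esub> d = \<zero>\<^bsub>Hom D X X\<^esub>"
    unfolding d_def using cmp_minus_right[OF X X X e idX e] ee cmp_ident_right[OF X X e]
      minus_arrow_eq_zero_iff[OF X X e e] by simp
  have de: "d \<cdot>\<^bsub>D\<^esub> e = \<zero>\<^bsub>Hom D X X\<^esub>"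
    unfolding d_def using cmp_minus_left[OF X X X e idX e] ee cmp_ident_left[OF X X e]
      minus_arrow_eq_zero_iff[OF X X e e] by simp
  have e_d: "e \<oplus>\<^bsub>Hom D X X\<^esub> d = ident D X"
    unfolding d_def by (rule module_minus_add_cancel[OF Hom_module[OF X X] e idX])
  have dd: "d \<cdot>\<^bsub>D\<^esub> d = d"
    using cmp_add_left[OF X X X d e d] e_d ed cmp_ident_left[OF X X d]
      zero_add_arrow[OF X X cmp_closed[OF X X X d d]] by simp
  let ?i = "\<lambda>n x. \<iota> n \<cdot>\<^bsub>D\<^esub> x"
  have i: "?i n x \<in> arrows D X Y" if "x \<in> arrows D X X" for n x
    by (rule cmp_closed[OF X X Y that \<iota>])
  let ?z = "\<zero>\<^bsub>Hom D X Y\<^esub>"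
  have z: "?z \<in> arrows D X Y" by (rule zero_arrow[OF X Y])
  have iz: "?i n \<zero>\<^bsub>Hom D X X\<^esub> = ?z" for n by (rule cmp_zero_right[OF X X Y \<iota>])
  have split: "?i n e \<oplus>\<^bsub>Hom D X Y\<^esub> ?i n d = \<iota> n" for n
    using cmp_add_right[OF X X Y \<iota> e d] e_d cmp_ident_right[OF X Y \<iota>] by simp
  have split': "?i n d \<oplus>\<^bsub>Hom D X Y\<^esub> ?i n e = \<iota> n" for n
  proof -
    interpret module R "Hom D X Y" using Hom_module X Y by blast
    show ?thesis using split[of n] M.a_comm[OF i[OF d] i[OF e]] by simp
  qed
  obtain s where s: "s \<in> arrows D Y Y"
    and s\<iota>: "\<And>n. s \<cdot>\<^bsub>D\<^esub> \<iota> n = ?i n d \<oplus>\<^bsub>Hom D X Y\<^esub> ?i (Suc n) e"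
    using coproduct_map[OF cop Y, of "\<lambda>n. ?i n d \<oplus>\<^bsub>Hom D X Y\<^esub> ?i (Suc n) e"]
      add_arrow[OF X Y i[OF d] i[OF e]] by auto
  \<comment> \<open>The \<open>E\<close>-part of copy \<open>n\<close>, moved back to copy \<open>n - 1\<close>; it is dropped for \<open>n = 0\<close>.\<close>
  define e' where "e' n = (case n of 0 \<Rightarrow> ?z | Suc m \<Rightarrow> ?i m e)" for n
  have e': "e' n \<in> arrows D X Y" for n
    using z i[OF e] by (simp add: e'_def split: nat.split)
  obtain r where r: "r \<in> arrows D Y Y" and r\<iota>: "\<And>n. r \<cdot>\<^bsub>D\<^esub> \<iota> n = ?i n d \<oplus>\<^bsub>Hom D X Y\<^esub> e' n"
    using coproduct_map[OF cop Y, of "\<lambda>n. ?i n d \<oplus>\<^bsub>Hom D X Y\<^esub> e' n"]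
      add_arrow[OF X Y i[OF d] e'] by auto
  obtain \<pi> where \<pi>: "\<pi> \<in> arrows D Y X"
    and \<pi>\<iota>: "\<And>n. \<pi> \<cdot>\<^bsub>D\<^esub> \<iota> n = (if n = 0 then e else \<zero>\<^bsub>Hom D X X\<^esub>)"
    using coproduct_map[OF cop X, of "\<lambda>n. if n = 0 then e else \<zero>\<^bsub>Hom D X X\<^esub>"]
      zero_arrow[OF X X] e by (smt (verit) UNIV_I)
  have e'e: "e' n \<cdot>\<^bsub>D\<^esub> e = e' n" and e'd: "e' n \<cdot>\<^bsub>D\<^esub> d = ?z" for n
    using cmp_assoc[OF X X X Y e e \<iota>] cmp_assoc[OF X X X Y d e \<iota>] ee ed iz
      cmp_zero_left[OF X X Y e] cmp_zero_left[OF X X Y d]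
    by (simp_all add: e'_def split: nat.split)
  have ide: "?i n d \<cdot>\<^bsub>D\<^esub> e = ?z" and idd: "?i n d \<cdot>\<^bsub>D\<^esub> d = ?i n d"
    and iee: "?i n e \<cdot>\<^bsub>D\<^esub> e = ?i n e" and ied: "?i n e \<cdot>\<^bsub>D\<^esub> d = ?z" for n
    using cmp_assoc[OF X X X Y e d \<iota>] cmp_assoc[OF X X X Y d d \<iota>] cmp_assoc[OF X X X Y e e \<iota>]
      cmp_assoc[OF X X X Y d e \<iota>] de dd ee ed iz by simp_all
  have r_id: "r \<cdot>\<^bsub>D\<^esub> ?i n d = ?i n d" and r_ie: "r \<cdot>\<^bsub>D\<^esub> ?i n e = e' n" for n
  proof -
    have "r \<cdot>\<^bsub>D\<^esub> ?i n d = (?i n d \<oplus>\<^bsub>Hom D X Y\<^esub> e' n) \<cdot>\<^bsub>D\<^esub> d"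
      using cmp_assoc[OF X X Y Y d \<iota> r] r\<iota> by simp
    then show "r \<cdot>\<^bsub>D\<^esub> ?i n d = ?i n d"
      using cmp_add_left[OF X X Y d i[OF d] e'] idd e'd add_zero_arrow[OF X Y i[OF d]] by simp
    have "r \<cdot>\<^bsub>D\<^esub> ?i n e = (?i n d \<oplus>\<^bsub>Hom D X Y\<^esub> e' n) \<cdot>\<^bsub>D\<^esub> e"
      using cmp_assoc[OF X X Y Y e \<iota> r] r\<iota> by simp
    then show "r \<cdot>\<^bsub>D\<^esub> ?i n e = e' n"
      using cmp_add_left[OF X X Y e i[OF d] e'] ide e'e zero_add_arrow[OF X Y e'] by simp
  qed
  have s_id: "s \<cdot>\<^bsub>D\<^esub> ?i n d = ?i n d" and s_ie: "s \<cdot>\<^bsub>D\<^esub> ?i n e = ?i (Suc n) e" for n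
  proof -
    have "s \<cdot>\<^bsub>D\<^esub> ?i n d = (?i n d \<oplus>\<^bsub>Hom D X Y\<^esub> ?i (Suc n) e) \<cdot>\<^bsub>D\<^esub> d"
      using cmp_assoc[OF X X Y Y d \<iota> s] s\<iota> by simp
    then show "s \<cdot>\<^bsub>D\<^esub> ?i n d = ?i n d"
      using cmp_add_left[OF X X Y d i[OF d] i[OF e]] idd ied add_zero_arrow[OF X Y i[OF d]] by simp
    have "s \<cdot>\<^bsub>D\<^esub> ?i n e = (?i n d \<oplus>\<^bsub>Hom D X Y\<^esub> ?i (Suc n) e) \<cdot>\<^bsub>D\<^esub> e"
      using cmp_assoc[OF X X Y Y e \<iota> s] s\<iota> by simp
    then show "s \<cdot>\<^bsub>D\<^esub> ?i n e = ?i (Suc n) e"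
      using cmp_add_left[OF X X Y e i[OF d] i[OF e]] ide iee zero_add_arrow[OF X Y i[OF e]] by simp
  qed
  have \<pi>_id: "\<pi> \<cdot>\<^bsub>D\<^esub> ?i n d = \<zero>\<^bsub>Hom D X X\<^esub>" for n
    using cmp_assoc[OF X X Y X d \<iota> \<pi>] \<pi>\<iota> ed cmp_zero_left[OF X X X d] by simp
  have \<pi>_ie: "\<pi> \<cdot>\<^bsub>D\<^esub> ?i n e = (if n = 0 then e else \<zero>\<^bsub>Hom D X X\<^esub>)" for n
    using cmp_assoc[OF X X Y X e \<iota> \<pi>] \<pi>\<iota> ee cmp_zero_left[OF X X X e] by simp
  define q where "q = \<iota> 0 \<cdot>\<^bsub>D\<^esub> \<pi>"
  have q: "q \<in> arrows D Y Y" unfolding q_def by (rule cmp_closed[OF Y X Y \<pi> \<iota>])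
  have rs: "r \<cdot>\<^bsub>D\<^esub> s = ident D Y"
  proof (rule coproduct_ext[OF cop Y cmp_closed[OF Y Y Y s r] ident_arrow[OF Y]])
    fix n
    have "(r \<cdot>\<^bsub>D\<^esub> s) \<cdot>\<^bsub>D\<^esub> \<iota> n = ?i n d \<oplus>\<^bsub>Hom D X Y\<^esub> e' (Suc n)"
      using cmp_assoc[OF X Y Y Y \<iota> s r] s\<iota> cmp_add_right[OF X Y Y r i[OF d] i[OF e]] r_id r_ie by simp
    then show "(r \<cdot>\<^bsub>D\<^esub> s) \<cdot>\<^bsub>D\<^esub> \<iota> n = ident D Y \<cdot>\<^bsub>D\<^esub> \<iota> n"
      using split' cmp_ident_left[OF X Y \<iota>] by (simp add: e'_def)
  qed
  have qs: "q \<cdot>\<^bsub>D\<^esub> s = \<zero>\<^bsub>Hom D Y Y\<^esub>"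
  proof (rule coproduct_ext[OF cop Y cmp_closed[OF Y Y Y s q] zero_arrow[OF Y Y]])
    fix n
    have "\<pi> \<cdot>\<^bsub>D\<^esub> (s \<cdot>\<^bsub>D\<^esub> \<iota> n) = \<zero>\<^bsub>Hom D X X\<^esub>"
      using s\<iota> cmp_add_right[OF X Y X \<pi> i[OF d] i[OF e]] \<pi>_id \<pi>_ie
        add_zero_arrow[OF X X zero_arrow[OF X X]] by simp
    then have "q \<cdot>\<^bsub>D\<^esub> (s \<cdot>\<^bsub>D\<^esub> \<iota> n) = ?z"
      unfolding q_def using cmp_assoc[OF X Y X Y cmp_closed[OF X Y Y \<iota> s] \<pi> \<iota>] iz by metis
    then show "(q \<cdot>\<^bsub>D\<^esub> s) \<cdot>\<^bsub>D\<^esub> \<iota> n = \<zero>\<^bsub>Hom D Y Y\<^esub> \<cdot>\<^bsub>D\<^esub> \<iota> n"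
      using cmp_assoc[OF X Y Y Y \<iota> s q] cmp_zero_left[OF X Y Y \<iota>] by simp
  qed
  have sr: "s \<cdot>\<^bsub>D\<^esub> r \<in> arrows D Y Y" by (rule cmp_closed[OF Y Y Y r s])
  have sum: "q \<oplus>\<^bsub>Hom D Y Y\<^esub> (s \<cdot>\<^bsub>D\<^esub> r) = ident D Y"
  proof (rule coproduct_ext[OF cop Y add_arrow[OF Y Y q sr] ident_arrow[OF Y]])
    fix n
    have "q \<cdot>\<^bsub>D\<^esub> \<iota> n = (if n = 0 then ?i 0 e else ?z)"
      unfolding q_def using cmp_assoc[OF X Y X Y \<iota>[of n] \<pi> \<iota>[of 0]] \<pi>\<iota>[of n] iz[of 0] by (auto split: if_splits)
    moreover have "(s \<cdot>\<^bsub>D\<^esub> r) \<cdot>\<^bsub>D\<^esub> \<iota> n = ?i n d \<oplus>\<^bsub>Hom D X Y\<^esub> (s \<cdot>\<^bsub>D\<^esub> e' n)"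
      using cmp_assoc[OF X Y Y Y \<iota> r s] r\<iota> cmp_add_right[OF X Y Y s i[OF d] e'] s_id by simp
    ultimately show "(q \<oplus>\<^bsub>Hom D Y Y\<^esub> (s \<cdot>\<^bsub>D\<^esub> r)) \<cdot>\<^bsub>D\<^esub> \<iota> n = ident D Y \<cdot>\<^bsub>D\<^esub> \<iota> n"
      using cmp_add_left[OF X Y Y \<iota> q sr] cmp_ident_left[OF X Y \<iota>] split split' s_ie
        cmp_zero_right[OF X Y Y s] add_zero_arrow[OF X Y i[OF d]] zero_add_arrow[OF X Y \<iota>]
      by (cases n) (simp_all add: e'_def)
  qed
  obtain Z g k where Z: "Z \<in> Ob D" and g: "g \<in> arrows D Y Z" and k: "k \<in> arrows D Z Y"
    and kg: "k \<cdot>\<^bsub>D\<^esub> g = q" and gk: "g \<cdot>\<^bsub>D\<^esub> k = ident D Z"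
    using split_mono_cokernel[OF Y s r q rs qs sum] by blast
  have p: "g \<cdot>\<^bsub>D\<^esub> \<iota> 0 \<in> arrows D X Z" by (rule cmp_closed[OF X Y Z \<iota> g])
  have i': "\<pi> \<cdot>\<^bsub>D\<^esub> k \<in> arrows D Z X" by (rule cmp_closed[OF Z Y X k \<pi>])
  have "(g \<cdot>\<^bsub>D\<^esub> \<iota> 0) \<cdot>\<^bsub>D\<^esub> (\<pi> \<cdot>\<^bsub>D\<^esub> k) = g \<cdot>\<^bsub>D\<^esub> (q \<cdot>\<^bsub>D\<^esub> k)"
    using cmp_assoc[OF Z X Y Z i' \<iota> g] cmp_assoc[OF Z Y X Y k \<pi> \<iota>] by (simp add: q_def)
  also have "\<dots> = ident D Z"
    using kg gk cmp_assoc[OF Z Y Z Y k g k] cmp_ident_right[OF Z Y k] by simp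
  finally have pi: "(g \<cdot>\<^bsub>D\<^esub> \<iota> 0) \<cdot>\<^bsub>D\<^esub> (\<pi> \<cdot>\<^bsub>D\<^esub> k) = ident D Z" .
  have q\<iota>: "q \<cdot>\<^bsub>D\<^esub> \<iota> 0 = ?i 0 e"
    unfolding q_def using cmp_assoc[OF X Y X Y \<iota>[of 0] \<pi> \<iota>[of 0]] \<pi>\<iota>[of 0] by simp
  have "(\<pi> \<cdot>\<^bsub>D\<^esub> k) \<cdot>\<^bsub>D\<^esub> (g \<cdot>\<^bsub>D\<^esub> \<iota> 0) = \<pi> \<cdot>\<^bsub>D\<^esub> (q \<cdot>\<^bsub>D\<^esub> \<iota> 0)"
    using cmp_assoc[OF X Z Y X p k \<pi>] cmp_assoc[OF X Y Z Y \<iota> g k] kg by simp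
  then have "(\<pi> \<cdot>\<^bsub>D\<^esub> k) \<cdot>\<^bsub>D\<^esub> (g \<cdot>\<^bsub>D\<^esub> \<iota> 0) = e"
    using q\<iota> \<pi>_ie[of 0] by simp
  then show thesis using that Z p i' pi by blast
qed

section \<open>The suspension preserves coproducts\<close>

lemma quasi_inverseD:
  assumes "quasi_inverse_equivalences R D D F G"
  shows "\<exists>\<eta>. (\<forall>X\<in>Ob D. is_iso D X (on_ob G (on_ob F X)) (\<eta> X)) \<and>
      (\<forall>X\<in>Ob D. \<forall>Y\<in>Ob D. \<forall>f\<in>arrows D X Y. \<eta> Y \<cdot>\<^bsub>D\<^esub> f = on_ar G (on_ar F f) \<cdot>\<^bsub>D\<^esub> \<eta> X)"
    "\<exists>\<epsilon>. (\<forall>X\<in>Ob D. is_iso D (on_ob F (on_ob G X)) X (\<epsilon> X)) \<and>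
      (\<forall>X\<in>Ob D. \<forall>Y\<in>Ob D. \<forall>f\<in>arrows D X Y. \<epsilon> Y \<cdot>\<^bsub>D\<^esub> on_ar F (on_ar G f) = f \<cdot>\<^bsub>D\<^esub> \<epsilon> X)"
  using assms by (simp_all add: quasi_inverse_equivalences_def naturally_isomorphic_def id_functor_def
        comp_functor_def)

lemma is_isoE:
  assumes "is_iso D X Y f"
  obtains g where "f \<in> arrows D X Y" "g \<in> arrows D Y X" "g \<cdot>\<^bsub>D\<^esub> f = ident D X" "f \<cdot>\<^bsub>D\<^esub> g = ident D Y"
  using assms by (auto simp: is_iso_def)

lemma susp_faithful:
  assumes X: "X \<in> Ob D" and Y: "Y \<in> Ob D" and f: "f \<in> arrows D X Y" and g: "g \<in> arrows D X Y"
    and eq: "sh_ar D f = sh_ar D g"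
  shows "f = g"
proof -
  let ?T = "\<lambda>X. on_ob (desusp D) (sh_ob D X)"
  obtain \<eta> where \<eta>: "is_iso D Y (?T Y) (\<eta> Y)"
    and nat: "\<forall>f\<in>arrows D X Y. \<eta> Y \<cdot>\<^bsub>D\<^esub> f = on_ar (desusp D) (sh_ar D f) \<cdot>\<^bsub>D\<^esub> \<eta> X"
    using quasi_inverseD(1)[OF shift_equivalence] X Y by meson
  have TY: "?T Y \<in> Ob D" using functor_ob[OF desusp_functor] sh_ob_closed[OF Y] by blast
  obtain \<theta> where \<eta>Y: "\<eta> Y \<in> arrows D Y (?T Y)" and \<theta>: "\<theta> \<in> arrows D (?T Y) Y"
    and \<theta>\<eta>: "\<theta> \<cdot>\<^bsub>D\<^esub> \<eta> Y = ident D Y"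
    using is_isoE[OF \<eta>] by metis
  have "\<eta> Y \<cdot>\<^bsub>D\<^esub> f = \<eta> Y \<cdot>\<^bsub>D\<^esub> g"
    using bspec[OF nat f] bspec[OF nat g] eq by simp
  moreover have "\<theta> \<cdot>\<^bsub>D\<^esub> (\<eta> Y \<cdot>\<^bsub>D\<^esub> u) = u" if "u \<in> arrows D X Y" for u
    using cmp_assoc[OF X Y TY Y that \<eta>Y \<theta>] \<theta>\<eta> cmp_ident_left[OF X Y that] by simp
  ultimately show ?thesis using f g by metis
qed

lemma desusp_faithful:
  assumes X: "X \<in> Ob D" and Y: "Y \<in> Ob D" and f: "f \<in> arrows D X Y" and g: "g \<in> arrows D X Y"
    and eq: "on_ar (desusp D) f = on_ar (desusp D) g"
  shows "f = g"
proof -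
  let ?T = "\<lambda>X. sh_ob D (on_ob (desusp D) X)"
  obtain \<epsilon> where \<epsilon>: "is_iso D (?T X) X (\<epsilon> X)"
    and nat: "\<forall>f\<in>arrows D X Y. \<epsilon> Y \<cdot>\<^bsub>D\<^esub> sh_ar D (on_ar (desusp D) f) = f \<cdot>\<^bsub>D\<^esub> \<epsilon> X"
    using quasi_inverseD(2)[OF shift_equivalence] X Y by meson
  have TX: "?T X \<in> Ob D" using functor_ob[OF desusp_functor X] sh_ob_closed by blast
  obtain \<delta> where \<epsilon>X: "\<epsilon> X \<in> arrows D (?T X) X" and \<delta>: "\<delta> \<in> arrows D X (?T X)"
    and \<epsilon>\<delta>: "\<epsilon> X \<cdot>\<^bsub>D\<^esub> \<delta> = ident D X"
    using is_isoE[OF \<epsilon>] by metis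
  have "f \<cdot>\<^bsub>D\<^esub> \<epsilon> X = g \<cdot>\<^bsub>D\<^esub> \<epsilon> X"
    using bspec[OF nat f] bspec[OF nat g] eq by simp
  moreover have "(u \<cdot>\<^bsub>D\<^esub> \<epsilon> X) \<cdot>\<^bsub>D\<^esub> \<delta> = u" if "u \<in> arrows D X Y" for u
    using cmp_assoc[OF X TX X Y \<delta> \<epsilon>X that] \<epsilon>\<delta> cmp_ident_right[OF X Y that] by simp
  ultimately show ?thesis using f g by metis
qed

text \<open>
  The natural isomorphism \<open>\<eta>\<close> between \<open>X\<close> and \<open>X[1][-1]\<close> transports \<open>h[-1]\<close> to a map \<open>f\<close> with
  \<open>f[1][-1] = h[-1]\<close>; faithfulness of \<open>[-1]\<close> then gives \<open>f[1] = h\<close>.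
\<close>
lemma susp_full:
  assumes X: "X \<in> Ob D" and Y: "Y \<in> Ob D" and h: "h \<in> arrows D (sh_ob D X) (sh_ob D Y)"
  obtains f where "f \<in> arrows D X Y" "sh_ar D f = h"
proof -
  let ?T = "\<lambda>X. on_ob (desusp D) (sh_ob D X)"
  obtain \<eta> where \<eta>X: "is_iso D X (?T X) (\<eta> X)" and \<eta>Y: "is_iso D Y (?T Y) (\<eta> Y)"
    and nat: "\<forall>f\<in>arrows D X Y. \<eta> Y \<cdot>\<^bsub>D\<^esub> f = on_ar (desusp D) (sh_ar D f) \<cdot>\<^bsub>D\<^esub> \<eta> X"
    using quasi_inverseD(1)[OF shift_equivalence] X Y by meson
  have sX: "sh_ob D X \<in> Ob D" and sY: "sh_ob D Y \<in> Ob D" using sh_ob_closed X Y by auto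
  have TX: "?T X \<in> Ob D" and TY: "?T Y \<in> Ob D"
    using functor_ob[OF desusp_functor] sX sY by auto
  obtain \<theta>X where eX: "\<eta> X \<in> arrows D X (?T X)" and tX: "\<theta>X \<in> arrows D (?T X) X"
    and etX: "\<eta> X \<cdot>\<^bsub>D\<^esub> \<theta>X = ident D (?T X)"
    using is_isoE[OF \<eta>X] by metis
  obtain \<theta>Y where eY: "\<eta> Y \<in> arrows D Y (?T Y)" and tY: "\<theta>Y \<in> arrows D (?T Y) Y"
    and etY: "\<eta> Y \<cdot>\<^bsub>D\<^esub> \<theta>Y = ident D (?T Y)"
    using is_isoE[OF \<eta>Y] by metis
  let ?h = "on_ar (desusp D) h"
  have h': "?h \<in> arrows D (?T X) (?T Y)" by (rule functor_ar[OF desusp_functor sX sY h])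
  define f where "f = \<theta>Y \<cdot>\<^bsub>D\<^esub> (?h \<cdot>\<^bsub>D\<^esub> \<eta> X)"
  have h\<eta>: "?h \<cdot>\<^bsub>D\<^esub> \<eta> X \<in> arrows D X (?T Y)" by (rule cmp_closed[OF X TX TY eX h'])
  have f: "f \<in> arrows D X Y" unfolding f_def by (rule cmp_closed[OF X TY Y h\<eta> tY])
  let ?g = "on_ar (desusp D) (sh_ar D f)"
  have g: "?g \<in> arrows D (?T X) (?T Y)"
    by (rule functor_ar[OF desusp_functor sX sY sh_ar_closed[OF X Y f]])
  have "?g \<cdot>\<^bsub>D\<^esub> \<eta> X = ?h \<cdot>\<^bsub>D\<^esub> \<eta> X"
    using bspec[OF nat f] cmp_assoc[OF X TY Y TY h\<eta> tY eY] etY cmp_ident_left[OF X TY h\<eta>]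
    by (simp add: f_def)
  moreover have "(u \<cdot>\<^bsub>D\<^esub> \<eta> X) \<cdot>\<^bsub>D\<^esub> \<theta>X = u" if "u \<in> arrows D (?T X) (?T Y)" for u
    using cmp_assoc[OF TX X TX TY tX eX that] etX cmp_ident_right[OF TX TY that] by simp
  ultimately have "?g = ?h" using g h' by metis
  then have "sh_ar D f = h"
    by (rule desusp_faithful[OF sX sY sh_ar_closed[OF X Y f] h])
  then show thesis using that f by blast
qed

lemma susp_essentially_surjective:
  assumes X: "X \<in> Ob D"
  obtains Y \<epsilon> where "Y \<in> Ob D" "is_iso D (sh_ob D Y) X \<epsilon>"
  using quasi_inverseD(2)[OF shift_equivalence] X functor_ob[OF desusp_functor X] by meson

text \<open>
  Every target \<open>W\<close> is isomorphic to some \<open>V[1]\<close>, and maps \<open>F i[1] \<rightarrow> V[1]\<close> are the same as maps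
  \<open>F i \<rightarrow> V\<close> because the suspension is fully faithful.
\<close>
lemma susp_coproduct:
  assumes cop: "is_coproduct D I F S \<iota>"
  shows "is_coproduct D I (\<lambda>i. sh_ob D (F i)) (sh_ob D S) (\<lambda>i. sh_ar D (\<iota> i))"
proof -
  have F: "F i \<in> Ob D" and \<iota>: "\<iota> i \<in> arrows D (F i) S" if "i \<in> I" for i
    using cop that by (auto simp: is_coproduct_def)
  have S: "S \<in> Ob D" using cop by (auto simp: is_coproduct_def)
  note sS = sh_ob_closed[OF S]
  have "\<exists>!h. h \<in> arrows D (sh_ob D S) W \<and> (\<forall>i\<in>I. h \<cdot>\<^bsub>D\<^esub> sh_ar D (\<iota> i) = f i)"
    if W: "W \<in> Ob D" and f: "\<forall>i\<in>I. f i \<in> arrows D (sh_ob D (F i)) W" for W f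
  proof -
    obtain V \<epsilon> where V: "V \<in> Ob D" and iso: "is_iso D (sh_ob D V) W \<epsilon>"
      using susp_essentially_surjective[OF W] by blast
    note sV = sh_ob_closed[OF V]
    obtain \<delta> where \<epsilon>: "\<epsilon> \<in> arrows D (sh_ob D V) W" and \<delta>: "\<delta> \<in> arrows D W (sh_ob D V)"
      and \<epsilon>\<delta>: "\<epsilon> \<cdot>\<^bsub>D\<^esub> \<delta> = ident D W"
      using is_isoE[OF iso] by metis
    have cancel: "\<epsilon> \<cdot>\<^bsub>D\<^esub> (\<delta> \<cdot>\<^bsub>D\<^esub> x) = x" if "X \<in> Ob D" "x \<in> arrows D X W" for X x
      using cmp_assoc[OF that(1) W sV W that(2) \<delta> \<epsilon>] \<epsilon>\<delta> cmp_ident_left[OF that(1) W that(2)] by simp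
    have "\<forall>i\<in>I. \<exists>u. u \<in> arrows D (F i) V \<and> sh_ar D u = \<delta> \<cdot>\<^bsub>D\<^esub> f i"
    proof
      fix i assume i: "i \<in> I"
      from susp_full[OF F[OF i] V cmp_closed[OF sh_ob_closed[OF F[OF i]] W sV bspec[OF f i] \<delta>]]
      show "\<exists>u. u \<in> arrows D (F i) V \<and> sh_ar D u = \<delta> \<cdot>\<^bsub>D\<^esub> f i" by blast
    qed
    from bchoice[OF this] obtain u where
      u: "\<And>i. i \<in> I \<Longrightarrow> u i \<in> arrows D (F i) V" "\<And>i. i \<in> I \<Longrightarrow> sh_ar D (u i) = \<delta> \<cdot>\<^bsub>D\<^esub> f i" by blast
    obtain v where v: "v \<in> arrows D S V" "\<And>i. i \<in> I \<Longrightarrow> v \<cdot>\<^bsub>D\<^esub> \<iota> i = u i"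
      using coproduct_map[OF cop V u(1)] by blast
    show ?thesis
    proof (rule ex1I[of _ "\<epsilon> \<cdot>\<^bsub>D\<^esub> sh_ar D v"], intro conjI ballI)
      show "\<epsilon> \<cdot>\<^bsub>D\<^esub> sh_ar D v \<in> arrows D (sh_ob D S) W"
        by (rule cmp_closed[OF sS sV W sh_ar_closed[OF S V v(1)] \<epsilon>])
    next
      fix i assume i: "i \<in> I"
      note sF = sh_ob_closed[OF F[OF i]]
      show "(\<epsilon> \<cdot>\<^bsub>D\<^esub> sh_ar D v) \<cdot>\<^bsub>D\<^esub> sh_ar D (\<iota> i) = f i"
        using cmp_assoc[OF sF sS sV W sh_ar_closed[OF F[OF i] S \<iota>[OF i]] sh_ar_closed[OF S V v(1)] \<epsilon>]
          sh_ar_cmp[OF F[OF i] S V \<iota>[OF i] v(1)] v(2)[OF i] u(2)[OF i] cancel[OF sF bspec[OF f i]]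
        by simp
    next
      fix h assume h': "h \<in> arrows D (sh_ob D S) W \<and> (\<forall>i\<in>I. h \<cdot>\<^bsub>D\<^esub> sh_ar D (\<iota> i) = f i)"
      then have h: "h \<in> arrows D (sh_ob D S) W" and hi: "\<forall>i\<in>I. h \<cdot>\<^bsub>D\<^esub> sh_ar D (\<iota> i) = f i" by blast+
      obtain w where w: "w \<in> arrows D S V" "sh_ar D w = \<delta> \<cdot>\<^bsub>D\<^esub> h"
        using susp_full[OF S V cmp_closed[OF sS W sV h \<delta>]] by blast
      have "w = v"
      proof (rule coproduct_ext[OF cop V w(1) v(1)])
        fix i assume i: "i \<in> I"
        note sF = sh_ob_closed[OF F[OF i]]
        have "sh_ar D (w \<cdot>\<^bsub>D\<^esub> \<iota> i) = sh_ar D (v \<cdot>\<^bsub>D\<^esub> \<iota> i)"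
          using sh_ar_cmp[OF F[OF i] S V \<iota>[OF i] w(1)] w(2) v(2)[OF i] u(2)[OF i] bspec[OF hi i]
            cmp_assoc[OF sF sS W sV sh_ar_closed[OF F[OF i] S \<iota>[OF i]] h \<delta>] by simp
        then show "w \<cdot>\<^bsub>D\<^esub> \<iota> i = v \<cdot>\<^bsub>D\<^esub> \<iota> i"
          by (rule susp_faithful[OF F[OF i] V cmp_closed[OF F[OF i] S V \<iota>[OF i] w(1)]
                cmp_closed[OF F[OF i] S V \<iota>[OF i] v(1)]])
      qed
      then show "h = \<epsilon> \<cdot>\<^bsub>D\<^esub> sh_ar D v"
        using w(2) cancel[OF sS h] by simp
    qed
  qed
  then show ?thesis
    using sS sh_ob_closed F sh_ar_closed[OF F S \<iota>] unfolding is_coproduct_def by blast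
qed

end

section \<open>Small sets and small coproducts\<close>

lemma small_subset: "small \<kappa> B \<Longrightarrow> A \<subseteq> B \<Longrightarrow> small \<kappa> A"
  unfolding small_def by (meson card_of_mono1 ordLeq_ordLess_trans)

lemma small_image: "small \<kappa> A \<Longrightarrow> small \<kappa> (f ` A)"
  unfolding small_def by (meson card_of_image ordLeq_ordLess_trans)

lemma small_Sigma:
  assumes \<kappa>: "universe_cardinal \<kappa>" and "small \<kappa> A" "\<And>a. a \<in> A \<Longrightarrow> small \<kappa> (B a)"
  shows "small \<kappa> (SIGMA a:A. B a)"
proof -
  have "\<not> finite (Field \<kappa>)"
    using \<kappa> unfolding universe_cardinal_def
    by (metis Card_order_iff_ordLeq_card_of card_of_Field_ordIso finite_iff_ordLess_natLeq
        not_ordLess_ordIso ordIso_ordLess_trans ordLess_ordIso_trans ordLess_transitive ordLess_irreflexive)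
  then have "stable \<kappa>"
    using \<kappa> regularCard_stable by (auto simp: universe_cardinal_def)
  then show ?thesis
    using assms(2,3) unfolding small_def by (rule stable_elim)
qed

lemma small_nat: "universe_cardinal \<kappa> \<Longrightarrow> small \<kappa> (UNIV :: nat set)"
  unfolding small_def universe_cardinal_def by (metis card_of_nat ordIso_ordLess_trans)

lemma small_embedding:
  fixes \<kappa> :: "'u rel" and A :: "'a set"
  assumes \<kappa>: "universe_cardinal \<kappa>" and "small \<kappa> A"
  obtains \<phi> :: "'a \<Rightarrow> 'u" where "inj_on \<phi> A" "small \<kappa> (\<phi> ` A)"
proof -
  have "|A| \<le>o |Field \<kappa>|"
    using assms unfolding universe_cardinal_def small_def
    by (meson card_of_Field_ordIso ordIso_symmetric ordLess_imp_ordLeq ordLess_ordIso_trans)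
  then obtain \<phi> where "inj_on \<phi> A" "\<phi> ` A \<subseteq> Field \<kappa>"
    using card_of_ordLeq[of A "Field \<kappa>"] by blast
  then show thesis using that small_image[OF assms(2)] by blast
qed

lemma (in linear_category) reindex_coproduct:
  assumes bij: "bij_betw \<phi> A B" and cop: "is_coproduct C B F' S \<iota>'"
    and F: "\<And>a. a \<in> A \<Longrightarrow> F a = F' (\<phi> a)" and \<iota>: "\<And>a. a \<in> A \<Longrightarrow> \<iota> a = \<iota>' (\<phi> a)"
  shows "is_coproduct C A F S \<iota>"
proof -
  let ?\<psi> = "inv_into A \<phi>"
  have \<phi>: "\<phi> a \<in> B" "?\<psi> (\<phi> a) = a" if "a \<in> A" for a
    using bij that by (auto simp: bij_betw_def)
  have \<psi>: "?\<psi> b \<in> A" "\<phi> (?\<psi> b) = b" if "b \<in> B" for b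
    using bij that by (auto simp: bij_betw_def inv_into_into f_inv_into_f)
  have S: "S \<in> Ob C" and F': "\<And>b. b \<in> B \<Longrightarrow> F' b \<in> Ob C"
    and \<iota>': "\<And>b. b \<in> B \<Longrightarrow> \<iota>' b \<in> arrows C (F' b) S"
    using cop by (auto simp: is_coproduct_def)
  have "\<exists>!h. h \<in> arrows C S Y \<and> (\<forall>a\<in>A. h \<cdot>\<^bsub>C\<^esub> \<iota> a = f a)"
    if Y: "Y \<in> Ob C" and f: "\<forall>a\<in>A. f a \<in> arrows C (F a) Y" for Y f
  proof -
    have f': "f (?\<psi> b) \<in> arrows C (F' b) Y" if "b \<in> B" for b
      using f F \<psi>[OF that] by metis
    obtain h where h: "h \<in> arrows C S Y" and h\<iota>: "\<And>b. b \<in> B \<Longrightarrow> h \<cdot>\<^bsub>C\<^esub> \<iota>' b = f (?\<psi> b)"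
      using coproduct_map[OF cop Y f'] by blast
    show ?thesis
    proof (rule ex1I[of _ h], intro conjI ballI h)
      fix a assume "a \<in> A"
      then show "h \<cdot>\<^bsub>C\<^esub> \<iota> a = f a" using h\<iota>[of "\<phi> a"] \<phi> \<iota> by simp
    next
      fix k assume k: "k \<in> arrows C S Y \<and> (\<forall>a\<in>A. k \<cdot>\<^bsub>C\<^esub> \<iota> a = f a)"
      show "k = h"
      proof (rule coproduct_ext[OF cop Y conjunct1[OF k] h])
        fix b assume "b \<in> B"
        then show "k \<cdot>\<^bsub>C\<^esub> \<iota>' b = h \<cdot>\<^bsub>C\<^esub> \<iota>' b"
          using bspec[OF conjunct2[OF k], of "?\<psi> b"] h\<iota>[of b] \<psi> \<iota>[of "?\<psi> b"] by simp
      qed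
    qed
  qed
  then show ?thesis
    using S F' \<iota>' F \<iota> \<phi>(1) unfolding is_coproduct_def by (simp add: Pi_iff)
qed

text \<open>
  Coproducts are available for index sets in the type underlying \<open>\<kappa>\<close>; the construction below
  indexes them by sets of pairs (object, element) and (object, arrow).
\<close>
lemma (in linear_category) small_coproduct:
  fixes \<kappa> :: "'u rel"
  assumes \<kappa>: "universe_cardinal \<kappa>" and "has_coproducts \<kappa> C" and A: "small \<kappa> A"
    and F: "\<And>a. a \<in> A \<Longrightarrow> F a \<in> Ob C"
  obtains S \<iota> where "is_coproduct C A F S \<iota>"
proof -
  obtain \<phi> :: "_ \<Rightarrow> 'u" where \<phi>: "inj_on \<phi> A" "small \<kappa> (\<phi> ` A)"
    using small_embedding[OF \<kappa> A] by blast
  let ?F = "\<lambda>b. F (inv_into A \<phi> b)"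
  have "?F \<in> \<phi> ` A \<rightarrow> Ob C" using F by (auto simp: \<phi>(1))
  then obtain S \<iota> where "is_coproduct C (\<phi> ` A) ?F S \<iota>"
    using assms(2) \<phi>(2) unfolding has_coproducts_def by blast
  then have "is_coproduct C A F S (\<lambda>a. \<iota> (\<phi> a))"
    by (rule reindex_coproduct[OF inj_on_imp_bij_betw[OF \<phi>(1)]]) (simp_all add: \<phi>(1))
  then show thesis by (rule that)
qed

section \<open>Cohomological functors that preserve products\<close>

locale cohomological_functor = linear_triangulated_category R D
  for R :: "('r, 's) ring_scheme" and D :: "('r, 'o, 'm, 'z) tri_cat_scheme" +
  fixes \<kappa> :: "'u rel" and M :: "('r, 'o, 'm, 'x) module_functor"
  assumes universe: "universe_cardinal \<kappa>"
    and contra: "contravariant_functor \<kappa> R D M"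
    and cohom: "cohomological D M"
    and products: "coproducts_to_products \<kappa> D M"
begin

lemma M_module: "X \<in> Ob D \<Longrightarrow> module R (on_ob M X)"
  and M_small: "X \<in> Ob D \<Longrightarrow> small \<kappa> (carrier (on_ob M X))"
  and M_linear: "X \<in> Ob D \<Longrightarrow> Y \<in> Ob D \<Longrightarrow> f \<in> arrows D X Y
    \<Longrightarrow> on_ar M f \<in> linear_maps R (on_ob M Y) (on_ob M X)"
  and M_ident: "X \<in> Ob D \<Longrightarrow> x \<in> carrier (on_ob M X) \<Longrightarrow> on_ar M (ident D X) x = x"
  and M_cmp: "X \<in> Ob D \<Longrightarrow> Y \<in> Ob D \<Longrightarrow> Z \<in> Ob D \<Longrightarrow> f \<in> arrows D X Y \<Longrightarrow> g \<in> arrows D Y Z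
    \<Longrightarrow> x \<in> carrier (on_ob M Z) \<Longrightarrow> on_ar M (g \<cdot>\<^bsub>D\<^esub> f) x = on_ar M f (on_ar M g x)"
  using contra by (simp_all add: contravariant_functor_def)

lemma M_closed:
  "\<lbrakk>X \<in> Ob D; Y \<in> Ob D; f \<in> arrows D X Y; x \<in> carrier (on_ob M Y)\<rbrakk> \<Longrightarrow> on_ar M f x \<in> carrier (on_ob M X)"
  by (rule linear_map_closed[OF M_linear])

lemma M_zero:
  "\<lbrakk>X \<in> Ob D; Y \<in> Ob D; f \<in> arrows D X Y\<rbrakk> \<Longrightarrow> on_ar M f \<zero>\<^bsub>on_ob M Y\<^esub> = \<zero>\<^bsub>on_ob M X\<^esub>"
  by (rule linear_map_zero[OF M_module M_module M_linear])

lemma M_minus: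
  "\<lbrakk>X \<in> Ob D; Y \<in> Ob D; f \<in> arrows D X Y; x \<in> carrier (on_ob M Y); y \<in> carrier (on_ob M Y)\<rbrakk>
   \<Longrightarrow> on_ar M f (x \<ominus>\<^bsub>on_ob M Y\<^esub> y) = on_ar M f x \<ominus>\<^bsub>on_ob M X\<^esub> on_ar M f y"
  by (rule linear_map_minus[OF M_module M_module M_linear])

lemma evaluation_linear:
  "\<lbrakk>X \<in> Ob D; Y \<in> Ob D; y \<in> carrier (on_ob M Y)\<rbrakk>
   \<Longrightarrow> (\<lambda>f. on_ar M f y) \<in> linear_maps R (Hom D X Y) (on_ob M X)"
  using contra M_closed by (simp add: linear_maps_def contravariant_functor_def)

lemma M_add_arrow:
  "\<lbrakk>X \<in> Ob D; Y \<in> Ob D; f \<in> arrows D X Y; g \<in> arrows D X Y; y \<in> carrier (on_ob M Y)\<rbrakk>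
   \<Longrightarrow> on_ar M (f \<oplus>\<^bsub>Hom D X Y\<^esub> g) y = on_ar M f y \<oplus>\<^bsub>on_ob M X\<^esub> on_ar M g y"
  by (rule linear_map_add[OF evaluation_linear])

lemma M_minus_arrow:
  "\<lbrakk>X \<in> Ob D; Y \<in> Ob D; f \<in> arrows D X Y; g \<in> arrows D X Y; y \<in> carrier (on_ob M Y)\<rbrakk>
   \<Longrightarrow> on_ar M (f \<ominus>\<^bsub>Hom D X Y\<^esub> g) y = on_ar M f y \<ominus>\<^bsub>on_ob M X\<^esub> on_ar M g y"
  by (rule linear_map_minus[OF Hom_module M_module evaluation_linear])

lemma M_exact:
  assumes "Tri D X Y Z f g h" "y \<in> carrier (on_ob M Y)" "on_ar M f y = \<zero>\<^bsub>on_ob M X\<^esub>"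
  obtains z where "z \<in> carrier (on_ob M Z)" "on_ar M g z = y"
proof -
  have "on_ar M g ` carrier (on_ob M Z) = {y \<in> carrier (on_ob M Y). on_ar M f y = \<zero>\<^bsub>on_ob M X\<^esub>}"
    using cohom assms(1) unfolding cohomological_def by blast
  then have "y \<in> on_ar M g ` carrier (on_ob M Z)" using assms(2,3) by simp
  then show thesis using that by blast
qed

lemma M_complex:
  assumes "Tri D X Y Z f g h" "z \<in> carrier (on_ob M Z)"
  shows "on_ar M f (on_ar M g z) = \<zero>\<^bsub>on_ob M X\<^esub>"
  using cohom assms unfolding cohomological_def by blast

lemma M_coproduct:
  assumes A: "small \<kappa> A" and cop: "is_coproduct D A F S \<iota>"
  shows "bij_betw (\<lambda>x. \<lambda>a\<in>A. on_ar M (\<iota> a) x) (carrier (on_ob M S)) (\<Pi>\<^sub>E a\<in>A. carrier (on_ob M (F a)))"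
proof -
  obtain \<phi> :: "_ \<Rightarrow> 'u" where \<phi>: "inj_on \<phi> A" "small \<kappa> (\<phi> ` A)"
    using small_embedding[OF universe A] by blast
  let ?\<psi> = "inv_into A \<phi>"
  have \<psi>: "bij_betw ?\<psi> (\<phi> ` A) A" using \<phi>(1) by (simp add: bij_betw_inv_into inj_on_imp_bij_betw)
  have "is_coproduct D (\<phi> ` A) (F \<circ> ?\<psi>) S (\<iota> \<circ> ?\<psi>)"
    by (rule reindex_coproduct[OF \<psi> cop]) simp_all
  then have b: "bij_betw (\<lambda>x. \<lambda>b\<in>\<phi> ` A. on_ar M ((\<iota> \<circ> ?\<psi>) b) x) (carrier (on_ob M S))
      (\<Pi>\<^sub>E b\<in>\<phi> ` A. carrier (on_ob M ((F \<circ> ?\<psi>) b)))"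
    using products \<phi>(2) unfolding coproducts_to_products_def by blast
  have "bij_betw (\<lambda>y. \<lambda>a\<in>A. y (\<phi> a)) (\<Pi>\<^sub>E b\<in>\<phi> ` A. carrier (on_ob M ((F \<circ> ?\<psi>) b)))
      (\<Pi>\<^sub>E a\<in>A. carrier (on_ob M (F a)))"
    by (rule bij_betwI[where g = "\<lambda>y. \<lambda>b\<in>\<phi> ` A. y (?\<psi> b)"])
      (auto simp: \<phi>(1) PiE_iff extensional_def fun_eq_iff Pi_iff)
  from bij_betw_trans[OF b this] show ?thesis
    by (rule iffD1[OF bij_betw_cong, rotated]) (auto simp: \<phi>(1))
qed

lemma M_coproduct_ext:
  assumes A: "small \<kappa> A" and cop: "is_coproduct D A F S \<iota>"
    and x: "x \<in> carrier (on_ob M S)" "y \<in> carrier (on_ob M S)"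
    and eq: "\<And>a. a \<in> A \<Longrightarrow> on_ar M (\<iota> a) x = on_ar M (\<iota> a) y"
  shows "x = y"
proof -
  have "(\<lambda>a\<in>A. on_ar M (\<iota> a) x) = (\<lambda>a\<in>A. on_ar M (\<iota> a) y)"
    using eq by (auto simp: restrict_def)
  then show ?thesis
    using bij_betw_imp_inj_on[OF M_coproduct[OF A cop]] x by (auto dest: inj_onD)
qed

lemma M_coproduct_element:
  assumes A: "small \<kappa> A" and cop: "is_coproduct D A F S \<iota>"
    and y: "\<And>a. a \<in> A \<Longrightarrow> y a \<in> carrier (on_ob M (F a))"
  obtains x where "x \<in> carrier (on_ob M S)" "\<And>a. a \<in> A \<Longrightarrow> on_ar M (\<iota> a) x = y a"
proof -
  have "(\<lambda>a\<in>A. y a) \<in> (\<lambda>x. \<lambda>a\<in>A. on_ar M (\<iota> a) x) ` carrier (on_ob M S)"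
    using y bij_betw_imp_surj_on[OF M_coproduct[OF A cop]] by (simp add: restrict_PiE_iff)
  then obtain x where "x \<in> carrier (on_ob M S)" "(\<lambda>a\<in>A. y a) = (\<lambda>a\<in>A. on_ar M (\<iota> a) x)"
    by blast
  then show thesis using that by (metis restrict_apply')
qed

section \<open>Elements that cover and maps that kill\<close>

text \<open>
  By the Yoneda lemma an element \<open>x\<close> of \<open>M X\<close> is a natural transformation from \<open>Hom(-, X)\<close> to \<open>M\<close>.
  In these terms \<open>covers X x Y\<close> is its surjectivity at \<open>Y[1]\<close>, and \<open>kills t X x X' Y\<close> says that
  composing with \<open>t\<close> annihilates its kernel at \<open>Y\<close>.  The suspension in the first notion makes the
  two notions pass together from the outer terms of a triangle to the middle one: for
  \<open>A \<rightarrow> Y \<rightarrow> B \<rightarrow> A[1]\<close>, lifting an element of \<open>M (Y[1])\<close> meets an obstruction on \<open>B\<close>, and killing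
  a map on \<open>Y\<close> leads to an element of \<open>M (A[1])\<close>, so that the triangle
  only has to be rotated towards \<open>A[1] \<rightarrow> Y[1] \<rightarrow> B[1]\<close>.
\<close>
definition covers :: "'o \<Rightarrow> 'x \<Rightarrow> 'o \<Rightarrow> bool" where
  "covers X x Y \<longleftrightarrow> (\<forall>y\<in>carrier (on_ob M (sh_ob D Y)). \<exists>u\<in>arrows D (sh_ob D Y) X. on_ar M u x = y)"

definition kills :: "'m \<Rightarrow> 'o \<Rightarrow> 'x \<Rightarrow> 'o \<Rightarrow> 'o \<Rightarrow> bool" where
  "kills t X x X' Y \<longleftrightarrow>
     (\<forall>f\<in>arrows D Y X. on_ar M f x = \<zero>\<^bsub>on_ob M Y\<^esub> \<longrightarrow> t \<cdot>\<^bsub>D\<^esub> f = \<zero>\<^bsub>Hom D Y X'\<^esub>)"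

text \<open>Morphisms of the category of elements of \<open>M\<close>.\<close>
definition element_map :: "'m \<Rightarrow> 'o \<Rightarrow> 'x \<Rightarrow> 'o \<Rightarrow> 'x \<Rightarrow> bool" where
  "element_map t X x X' x' \<longleftrightarrow> X \<in> Ob D \<and> X' \<in> Ob D \<and> x \<in> carrier (on_ob M X) \<and>
     x' \<in> carrier (on_ob M X') \<and> t \<in> arrows D X X' \<and> on_ar M t x' = x"

lemma coversE:
  assumes "covers X x Y" "y \<in> carrier (on_ob M (sh_ob D Y))"
  obtains u where "u \<in> arrows D (sh_ob D Y) X" "on_ar M u x = y"
  using assms by (auto simp: covers_def)

lemma killsD:
  "\<lbrakk>kills t X x X' Y; f \<in> arrows D Y X; on_ar M f x = \<zero>\<^bsub>on_ob M Y\<^esub>\<rbrakk> \<Longrightarrow> t \<cdot>\<^bsub>D\<^esub> f = \<zero>\<^bsub>Hom D Y X'\<^esub>"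
  by (auto simp: kills_def)

lemma element_mapD:
  assumes "element_map t X x X' x'"
  shows "X \<in> Ob D" "X' \<in> Ob D" "x \<in> carrier (on_ob M X)" "x' \<in> carrier (on_ob M X')"
    "t \<in> arrows D X X'" "on_ar M t x' = x"
  using assms by (auto simp: element_map_def)

lemma element_map_push:
  assumes t: "element_map t X x X' x'" and W: "W \<in> Ob D" and f: "f \<in> arrows D W X"
  shows "on_ar M (t \<cdot>\<^bsub>D\<^esub> f) x' = on_ar M f x"
  using M_cmp[OF W element_mapD(1,2)[OF t] f element_mapD(5,4)[OF t]] element_mapD(6)[OF t] by simp

lemma element_map_cmp:
  assumes t: "element_map t X x X' x'" and t': "element_map t' X' x' X'' x''"
  shows "element_map (t' \<cdot>\<^bsub>D\<^esub> t) X x X'' x''"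
  using element_mapD[OF t] element_mapD[OF t'] element_map_push[OF t' element_mapD(1,5)[OF t]]
    cmp_closed[OF element_mapD(1,2)[OF t] element_mapD(2)[OF t'] element_mapD(5)[OF t] element_mapD(5)[OF t']]
  by (simp add: element_map_def)

lemma covers_push:
  assumes t: "element_map t X x X' x'" and Y: "Y \<in> Ob D" and c: "covers X x Y"
  shows "covers X' x' Y"
  unfolding covers_def
proof
  note sY = sh_ob_closed[OF Y]
  fix y assume "y \<in> carrier (on_ob M (sh_ob D Y))"
  then obtain u where u: "u \<in> arrows D (sh_ob D Y) X" "on_ar M u x = y" using coversE[OF c] by blast
  show "\<exists>u\<in>arrows D (sh_ob D Y) X'. on_ar M u x' = y"
    using element_map_push[OF t sY u(1)] u(2) cmp_closed[OF sY element_mapD(1,2)[OF t] u(1) element_mapD(5)[OF t]]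
    by blast
qed

lemma covers_summand:
  assumes X: "X \<in> Ob D" "x \<in> carrier (on_ob M X)" and c: "covers X x S" and s: "direct_summand D Y S"
  shows "covers X x Y"
  unfolding covers_def
proof
  obtain i p where Y: "Y \<in> Ob D" and S: "S \<in> Ob D" and i: "i \<in> arrows D Y S" and p: "p \<in> arrows D S Y"
    and pi: "p \<cdot>\<^bsub>D\<^esub> i = ident D Y" using direct_summand_retract[OF s] by blast
  note sY = sh_ob_closed[OF Y] and sS = sh_ob_closed[OF S]
  note si = sh_ar_closed[OF Y S i] and sp = sh_ar_closed[OF S Y p]
  fix y assume y: "y \<in> carrier (on_ob M (sh_ob D Y))"
  obtain u where u: "u \<in> arrows D (sh_ob D S) X" "on_ar M u x = on_ar M (sh_ar D p) y"
    using coversE[OF c M_closed[OF sS sY sp y]] by blast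
  have "on_ar M (u \<cdot>\<^bsub>D\<^esub> sh_ar D i) x = on_ar M (sh_ar D p \<cdot>\<^bsub>D\<^esub> sh_ar D i) y"
    using M_cmp[OF sY sS X(1) si u(1) X(2)] M_cmp[OF sY sS sY si sp y] u(2) by simp
  also have "\<dots> = y"
    using sh_ar_cmp[OF Y S Y i p] pi sh_ar_ident[OF Y] M_ident[OF sY y] by simp
  finally show "\<exists>u\<in>arrows D (sh_ob D Y) X. on_ar M u x = y"
    using cmp_closed[OF sY sS X(1) si u(1)] by blast
qed

lemma kills_summand:
  assumes X: "X \<in> Ob D" "x \<in> carrier (on_ob M X)" and X': "X' \<in> Ob D" and t: "t \<in> arrows D X X'"
    and c: "kills t X x X' S" and s: "direct_summand D Y S"
  shows "kills t X x X' Y"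
  unfolding kills_def
proof (intro ballI impI)
  obtain i p where Y: "Y \<in> Ob D" and S: "S \<in> Ob D" and i: "i \<in> arrows D Y S" and p: "p \<in> arrows D S Y"
    and pi: "p \<cdot>\<^bsub>D\<^esub> i = ident D Y" using direct_summand_retract[OF s] by blast
  fix f assume f: "f \<in> arrows D Y X" and f0: "on_ar M f x = \<zero>\<^bsub>on_ob M Y\<^esub>"
  note fp = cmp_closed[OF S Y X(1) p f]
  have "on_ar M (f \<cdot>\<^bsub>D\<^esub> p) x = \<zero>\<^bsub>on_ob M S\<^esub>"
    using M_cmp[OF S Y X(1) p f X(2)] f0 M_zero[OF S Y p] by simp
  then have "t \<cdot>\<^bsub>D\<^esub> (f \<cdot>\<^bsub>D\<^esub> p) = \<zero>\<^bsub>Hom D S X'\<^esub>"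
    by (rule killsD[OF c fp])
  then have "t \<cdot>\<^bsub>D\<^esub> ((f \<cdot>\<^bsub>D\<^esub> p) \<cdot>\<^bsub>D\<^esub> i) = \<zero>\<^bsub>Hom D Y X'\<^esub>"
    using cmp_assoc[OF Y S X(1) X' i fp t] cmp_zero_left[OF Y S X' i] by simp
  then show "t \<cdot>\<^bsub>D\<^esub> f = \<zero>\<^bsub>Hom D Y X'\<^esub>"
    using cmp_assoc[OF Y S Y X(1) i p f] pi cmp_ident_right[OF Y X(1) f] by simp
qed

lemma covers_coproduct:
  assumes X: "X \<in> Ob D" "x \<in> carrier (on_ob M X)"
    and A: "small \<kappa> A" and cop: "is_coproduct D A F S \<iota>" and c: "\<And>a. a \<in> A \<Longrightarrow> covers X x (F a)"
  shows "covers X x S"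
  unfolding covers_def
proof
  have F: "F a \<in> Ob D" and \<iota>: "\<iota> a \<in> arrows D (F a) S" if "a \<in> A" for a
    using cop that by (auto simp: is_coproduct_def)
  have S: "S \<in> Ob D" using cop by (auto simp: is_coproduct_def)
  note sS = sh_ob_closed[OF S] and cop' = susp_coproduct[OF cop]
  fix y assume y: "y \<in> carrier (on_ob M (sh_ob D S))"
  have "\<forall>a\<in>A. \<exists>u. u \<in> arrows D (sh_ob D (F a)) X \<and> on_ar M u x = on_ar M (sh_ar D (\<iota> a)) y"
  proof
    fix a assume a: "a \<in> A"
    show "\<exists>u. u \<in> arrows D (sh_ob D (F a)) X \<and> on_ar M u x = on_ar M (sh_ar D (\<iota> a)) y"
      using coversE[OF c[OF a] M_closed[OF sh_ob_closed[OF F[OF a]] sS sh_ar_closed[OF F[OF a] S \<iota>[OF a]] y]]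
      by blast
  qed
  from bchoice[OF this] obtain u where u: "\<And>a. a \<in> A \<Longrightarrow> u a \<in> arrows D (sh_ob D (F a)) X"
    "\<And>a. a \<in> A \<Longrightarrow> on_ar M (u a) x = on_ar M (sh_ar D (\<iota> a)) y" by blast
  obtain v where v: "v \<in> arrows D (sh_ob D S) X" "\<And>a. a \<in> A \<Longrightarrow> v \<cdot>\<^bsub>D\<^esub> sh_ar D (\<iota> a) = u a"
    using coproduct_map[OF cop' X(1) u(1)] by blast
  have "on_ar M v x = y"
  proof (rule M_coproduct_ext[OF A cop' M_closed[OF sS X(1) v(1) X(2)] y])
    fix a assume a: "a \<in> A"
    show "on_ar M (sh_ar D (\<iota> a)) (on_ar M v x) = on_ar M (sh_ar D (\<iota> a)) y"
      using M_cmp[OF sh_ob_closed[OF F[OF a]] sS X(1) sh_ar_closed[OF F[OF a] S \<iota>[OF a]] v(1) X(2)]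
        u(2)[OF a] v(2)[OF a] by simp
  qed
  then show "\<exists>u\<in>arrows D (sh_ob D S) X. on_ar M u x = y" using v(1) by blast
qed

lemma kills_coproduct:
  assumes X: "X \<in> Ob D" "x \<in> carrier (on_ob M X)" and X': "X' \<in> Ob D" and t: "t \<in> arrows D X X'"
    and cop: "is_coproduct D A F S \<iota>" and c: "\<And>a. a \<in> A \<Longrightarrow> kills t X x X' (F a)"
  shows "kills t X x X' S"
  unfolding kills_def
proof (intro ballI impI)
  have F: "F a \<in> Ob D" and \<iota>: "\<iota> a \<in> arrows D (F a) S" if "a \<in> A" for a
    using cop that by (auto simp: is_coproduct_def)
  have S: "S \<in> Ob D" using cop by (auto simp: is_coproduct_def)
  fix f assume f: "f \<in> arrows D S X" and f0: "on_ar M f x = \<zero>\<^bsub>on_ob M S\<^esub>"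
  show "t \<cdot>\<^bsub>D\<^esub> f = \<zero>\<^bsub>Hom D S X'\<^esub>"
  proof (rule coproduct_ext[OF cop X' cmp_closed[OF S X(1) X' f t] zero_arrow[OF S X']])
    fix a assume a: "a \<in> A"
    have "on_ar M (f \<cdot>\<^bsub>D\<^esub> \<iota> a) x = \<zero>\<^bsub>on_ob M (F a)\<^esub>"
      using M_cmp[OF F[OF a] S X(1) \<iota>[OF a] f X(2)] f0 M_zero[OF F[OF a] S \<iota>[OF a]] by simp
    then have "t \<cdot>\<^bsub>D\<^esub> (f \<cdot>\<^bsub>D\<^esub> \<iota> a) = \<zero>\<^bsub>Hom D (F a) X'\<^esub>"
      by (rule killsD[OF c[OF a] cmp_closed[OF F[OF a] S X(1) \<iota>[OF a] f]])
    then show "(t \<cdot>\<^bsub>D\<^esub> f) \<cdot>\<^bsub>D\<^esub> \<iota> a = \<zero>\<^bsub>Hom D S X'\<^esub> \<cdot>\<^bsub>D\<^esub> \<iota> a"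
      using cmp_assoc[OF F[OF a] S X(1) X' \<iota>[OF a] f t] cmp_zero_left[OF F[OF a] S X' \<iota>[OF a]] by simp
  qed
qed

lemma covers_Add:
  assumes "X \<in> Ob D" "x \<in> carrier (on_ob M X)" "\<And>s. s \<in> S \<Longrightarrow> covers X x s" "Y \<in> Add \<kappa> D S"
  shows "covers X x Y"
proof -
  obtain I :: "'u set" and F P \<iota> where "small \<kappa> I" "F \<in> I \<rightarrow> S" "is_coproduct D I F P \<iota>" "direct_summand D Y P"
    using assms(4) by (auto simp: Add_def)
  then show ?thesis
    using covers_summand[OF assms(1,2) covers_coproduct[OF assms(1,2)]] assms(3) by blast
qed

lemma kills_Add:
  assumes "X \<in> Ob D" "x \<in> carrier (on_ob M X)" "X' \<in> Ob D" "t \<in> arrows D X X'"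
    "\<And>s. s \<in> S \<Longrightarrow> kills t X x X' s" "Y \<in> Add \<kappa> D S"
  shows "kills t X x X' Y"
proof -
  obtain I :: "'u set" and F P \<iota> where "small \<kappa> I" "F \<in> I \<rightarrow> S" "is_coproduct D I F P \<iota>" "direct_summand D Y P"
    using assms(6) by (auto simp: Add_def)
  then show ?thesis
    using kills_summand[OF assms(1-4) kills_coproduct[OF assms(1-4)]] assms(5) by blast
qed

text \<open>
  A diagram chase as in the five lemma.  Given \<open>y\<close> in \<open>M (Y[1])\<close>, its restriction to \<open>A[1]\<close> is
  represented by a map \<open>u\<close> into \<open>X\<close>.  The obstruction to extending \<open>u\<close> to \<open>Y[1]\<close> is the map
  \<open>u \<cdot> h\<close> on \<open>B\<close>, on which \<open>x\<close> vanishes, so \<open>t \<cdot> u\<close> does extend.  The extension represents \<open>y\<close> up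
  to an element that vanishes on \<open>A[1]\<close>, hence comes from \<open>M (B[1])\<close> and is covered.
\<close>
lemma covers_extension:
  assumes T: "Tri D A Y B f g h" and t: "element_map t X x X' x'"
    and cA: "covers X x A" and kB: "kills t X x X' B" and cB: "covers X x B"
  shows "covers X' x' Y"
  unfolding covers_def
proof
  note d = TriD[OF T] and e = element_mapD[OF t]
  note A = d(1) and Y = d(2) and B = d(3)
  note sA = sh_ob_closed[OF A] and sY = sh_ob_closed[OF Y] and sB = sh_ob_closed[OF B]
  note T1 = Tri_rotated[OF Tri_rotated[OF T]]
  note T2 = Tri_rotated[OF T1]
  \<comment> \<open>The signs are those of the rotation axiom; the chase is insensitive to them.\<close>
  define f' where "f' = \<ominus>\<^bsub>Hom D (sh_ob D A) (sh_ob D Y)\<^esub> sh_ar D f"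
  define g' where "g' = \<ominus>\<^bsub>Hom D (sh_ob D Y) (sh_ob D B)\<^esub> sh_ar D g"
  note T1 = T1[folded f'_def g'_def] and T2 = T2[folded f'_def g'_def]
  have h: "h \<in> arrows D B (sh_ob D A)" and f': "f' \<in> arrows D (sh_ob D A) (sh_ob D Y)"
    and g': "g' \<in> arrows D (sh_ob D Y) (sh_ob D B)"
    using TriD[OF T1] by auto
  fix y assume y: "y \<in> carrier (on_ob M (sh_ob D Y))"
  obtain u where u: "u \<in> arrows D (sh_ob D A) X" "on_ar M u x = on_ar M f' y"
    using coversE[OF cA M_closed[OF sA sY f' y]] by blast
  note tu = cmp_closed[OF sA e(1,2) u(1) e(5)]
  have "on_ar M (u \<cdot>\<^bsub>D\<^esub> h) x = \<zero>\<^bsub>on_ob M B\<^esub>"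
    using M_cmp[OF B sA e(1) h u(1) e(3)] u(2) M_complex[OF T1 y] by simp
  then have "t \<cdot>\<^bsub>D\<^esub> (u \<cdot>\<^bsub>D\<^esub> h) = \<zero>\<^bsub>Hom D B X'\<^esub>"
    by (rule killsD[OF kB cmp_closed[OF B sA e(1) h u(1)]])
  then have "(t \<cdot>\<^bsub>D\<^esub> u) \<cdot>\<^bsub>D\<^esub> h = \<zero>\<^bsub>Hom D B X'\<^esub>"
    using cmp_assoc[OF B sA e(1,2) h u(1) e(5)] by simp
  then obtain w where w: "w \<in> arrows D (sh_ob D Y) X'" "w \<cdot>\<^bsub>D\<^esub> f' = t \<cdot>\<^bsub>D\<^esub> u"
    using Tri_extend[OF T1 e(2) tu] by blast
  let ?y = "on_ar M w x'"
  have wy: "?y \<in> carrier (on_ob M (sh_ob D Y))" by (rule M_closed[OF sY e(2) w(1) e(4)])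
  have "on_ar M f' ?y = on_ar M f' y"
    using M_cmp[OF sA sY e(2) f' w(1) e(4)] w(2) element_map_push[OF t sA u(1)] u(2) by simp
  then have "on_ar M f' (y \<ominus>\<^bsub>on_ob M (sh_ob D Y)\<^esub> ?y) = \<zero>\<^bsub>on_ob M (sh_ob D A)\<^esub>"
    using M_minus[OF sA sY f' y wy] M_closed[OF sA sY f' y]
      module_minus_eq_zero_iff[OF M_module[OF sA]] by simp
  then obtain z where z: "z \<in> carrier (on_ob M (sh_ob D B))"
    "on_ar M g' z = y \<ominus>\<^bsub>on_ob M (sh_ob D Y)\<^esub> ?y"
    using M_exact[OF T2 module_minus_closed[OF M_module[OF sY] y wy]] by blast
  obtain v where v: "v \<in> arrows D (sh_ob D B) X'" "on_ar M v x' = z"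
    using coversE[OF covers_push[OF t B cB] z(1)] by blast
  note vg = cmp_closed[OF sY sB e(2) g' v(1)]
  have "on_ar M (w \<oplus>\<^bsub>Hom D (sh_ob D Y) X'\<^esub> (v \<cdot>\<^bsub>D\<^esub> g')) x' = y"
    using M_add_arrow[OF sY e(2) w(1) vg e(4)] M_cmp[OF sY sB e(2) g' v(1) e(4)] v(2) z(2)
      module_minus_add_cancel[OF M_module[OF sY] wy y] by simp
  then show "\<exists>u\<in>arrows D (sh_ob D Y) X'. on_ar M u x' = y"
    using add_arrow[OF sY e(2) w(1) vg] by blast
qed

text \<open>
  If \<open>x\<close> vanishes on \<open>k : Y \<rightarrow> X\<close>, then \<open>t \<cdot> k\<close> vanishes on \<open>A\<close> and factors through some
  \<open>a : B \<rightarrow> X'\<close>.  The element that \<open>a\<close> represents vanishes on \<open>Y\<close>, so it comes from \<open>M (A[1])\<close> and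
  is represented by \<open>u \<cdot> h\<close> for a map \<open>u\<close> on \<open>A[1]\<close>.  Replacing \<open>a\<close> by \<open>a - u \<cdot> h\<close> does not change the
  restriction to \<open>Y\<close>, and \<open>t'\<close> kills the difference.
\<close>
lemma kills_extension:
  assumes T: "Tri D A Y B f g h" and t: "element_map t X x X' x'" and t': "element_map t' X' x' X'' x''"
    and kA: "kills t X x X' A" and cA: "covers X' x' A" and kB: "kills t' X' x' X'' B"
  shows "kills (t' \<cdot>\<^bsub>D\<^esub> t) X x X'' Y"
  unfolding kills_def
proof (intro ballI impI)
  note d = TriD[OF T] and e = element_mapD[OF t] and e' = element_mapD[OF t']
  note A = d(1) and Y = d(2) and B = d(3)
  note sA = sh_ob_closed[OF A]
  note T' = Tri_rotated[OF T]
  fix k assume k: "k \<in> arrows D Y X" and k0: "on_ar M k x = \<zero>\<^bsub>on_ob M Y\<^esub>"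
  note tk = cmp_closed[OF Y e(1,2) k e(5)]
  have "on_ar M (k \<cdot>\<^bsub>D\<^esub> f) x = \<zero>\<^bsub>on_ob M A\<^esub>"
    using M_cmp[OF A Y e(1) d(4) k e(3)] k0 M_zero[OF A Y d(4)] by simp
  then have "t \<cdot>\<^bsub>D\<^esub> (k \<cdot>\<^bsub>D\<^esub> f) = \<zero>\<^bsub>Hom D A X'\<^esub>"
    by (rule killsD[OF kA cmp_closed[OF A Y e(1) d(4) k]])
  then have "(t \<cdot>\<^bsub>D\<^esub> k) \<cdot>\<^bsub>D\<^esub> f = \<zero>\<^bsub>Hom D A X'\<^esub>"
    using cmp_assoc[OF A Y e(1,2) d(4) k e(5)] by simp
  then obtain a where a: "a \<in> arrows D B X'" "a \<cdot>\<^bsub>D\<^esub> g = t \<cdot>\<^bsub>D\<^esub> k"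
    using Tri_extend[OF T e(2) tk] by blast
  have "on_ar M g (on_ar M a x') = \<zero>\<^bsub>on_ob M Y\<^esub>"
    using M_cmp[OF Y B e(2) d(5) a(1) e(4)] a(2) element_map_push[OF t Y k] k0 by simp
  then obtain y where y: "y \<in> carrier (on_ob M (sh_ob D A))" "on_ar M h y = on_ar M a x'"
    using M_exact[OF T' M_closed[OF B e(2) a(1) e(4)]] by blast
  obtain u where u: "u \<in> arrows D (sh_ob D A) X'" "on_ar M u x' = y"
    using coversE[OF cA y(1)] by blast
  note uh = cmp_closed[OF B sA e(2) d(6) u(1)]
  let ?b = "a \<ominus>\<^bsub>Hom D B X'\<^esub> (u \<cdot>\<^bsub>D\<^esub> h)"
  have b: "?b \<in> arrows D B X'" by (rule minus_arrow[OF B e(2) a(1) uh])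
  have "on_ar M ?b x' = \<zero>\<^bsub>on_ob M B\<^esub>"
    using M_minus_arrow[OF B e(2) a(1) uh e(4)] M_cmp[OF B sA e(2) d(6) u(1) e(4)] u(2) y(2)
      module_minus_eq_zero_iff[OF M_module[OF B]] M_closed[OF B e(2) a(1) e(4)] by simp
  then have tb: "t' \<cdot>\<^bsub>D\<^esub> ?b = \<zero>\<^bsub>Hom D B X''\<^esub>"
    by (rule killsD[OF kB b])
  have "(u \<cdot>\<^bsub>D\<^esub> h) \<cdot>\<^bsub>D\<^esub> g = \<zero>\<^bsub>Hom D Y X'\<^esub>"
    using cmp_assoc[OF Y B sA e(2) d(5,6) u(1)] Tri_cmp_zero[OF T'] cmp_zero_right[OF Y sA e(2) u(1)]
    by simp
  then have "?b \<cdot>\<^bsub>D\<^esub> g = (t \<cdot>\<^bsub>D\<^esub> k) \<ominus>\<^bsub>Hom D Y X'\<^esub> \<zero>\<^bsub>Hom D Y X'\<^esub>"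
    using cmp_minus_left[OF Y B e(2) d(5) a(1) uh] a(2) by simp
  then have "t \<cdot>\<^bsub>D\<^esub> k = ?b \<cdot>\<^bsub>D\<^esub> g"
    using module_minus_add_cancel[OF Hom_module[OF Y e(2)] zero_arrow[OF Y e(2)] tk]
      zero_add_arrow[OF Y e(2)] cmp_closed[OF Y B e(2) d(5) b] by simp
  then have "(t' \<cdot>\<^bsub>D\<^esub> t) \<cdot>\<^bsub>D\<^esub> k = (t' \<cdot>\<^bsub>D\<^esub> ?b) \<cdot>\<^bsub>D\<^esub> g"
    using cmp_assoc[OF Y e(1,2) e'(2) k e(5) e'(5)] cmp_assoc[OF Y B e(2) e'(2) d(5) b e'(5)] by simp
  then show "(t' \<cdot>\<^bsub>D\<^esub> t) \<cdot>\<^bsub>D\<^esub> k = \<zero>\<^bsub>Hom D Y X''\<^esub>"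
    using tb cmp_zero_left[OF Y B e'(2) d(5)] by simp
qed

section \<open>Constructing covers and killing maps\<close>

text \<open>
  Take the coproduct of one copy of \<open>s[1]\<close> for every \<open>s\<close> in \<open>S\<close> and every element of \<open>M (s[1])\<close>,
  with the element of \<open>M\<close> at the coproduct whose components are all those elements.
\<close>
lemma exists_cover:
  assumes coproducts: "has_coproducts \<kappa> D" and S: "small \<kappa> S" "S \<subseteq> Ob D"
  obtains X x where "X \<in> Ob D" "x \<in> carrier (on_ob M X)" "\<And>s. s \<in> S \<Longrightarrow> covers X x s"
proof -
  define A where "A = (SIGMA s:S. carrier (on_ob M (sh_ob D s)))"
  have A: "small \<kappa> A"
    unfolding A_def using S sh_ob_closed M_small by (intro small_Sigma[OF universe]) auto
  have F: "sh_ob D (fst a) \<in> Ob D" and snd: "snd a \<in> carrier (on_ob M (sh_ob D (fst a)))" if "a \<in> A" for a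
    using that S sh_ob_closed by (auto simp: A_def)
  obtain X \<iota> where cop: "is_coproduct D A (\<lambda>a. sh_ob D (fst a)) X \<iota>"
    using small_coproduct[OF universe coproducts A F] .
  have X: "X \<in> Ob D" using cop by (simp add: is_coproduct_def)
  obtain x where x: "x \<in> carrier (on_ob M X)" "\<And>a. a \<in> A \<Longrightarrow> on_ar M (\<iota> a) x = snd a"
    using M_coproduct_element[OF A cop snd] by metis
  have "covers X x s" if "s \<in> S" for s
    unfolding covers_def
  proof
    fix y assume "y \<in> carrier (on_ob M (sh_ob D s))"
    then have a: "(s, y) \<in> A" using that by (simp add: A_def)
    have "\<forall>a\<in>A. \<iota> a \<in> arrows D (sh_ob D (fst a)) X"
      using cop by (simp add: is_coproduct_def)
    from bspec[OF this a] have "\<iota> (s, y) \<in> arrows D (sh_ob D s) X" by simp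
    then show "\<exists>u\<in>arrows D (sh_ob D s) X. on_ar M u x = y" using x(2)[OF a] by auto
  qed
  then show thesis using that X x(1) by blast
qed

text \<open>
  Let \<open>W\<close> be the coproduct of the sources of all maps from \<open>S\<close> to \<open>X\<close> on which \<open>x\<close> vanishes.  The
  cone of the induced map \<open>W \<rightarrow> X\<close> kills all of them, and since \<open>x\<close> vanishes on \<open>W\<close> it extends to
  the cone.
\<close>
lemma exists_kill:
  assumes coproducts: "has_coproducts \<kappa> D" and locally_small: "locally_small \<kappa> D"
    and S: "small \<kappa> S" "S \<subseteq> Ob D" and X: "X \<in> Ob D" "x \<in> carrier (on_ob M X)"
  obtains t X' x' where "element_map t X x X' x'" "\<And>s. s \<in> S \<Longrightarrow> kills t X x X' s"
proof -
  define A where "A = (SIGMA s:S. {f \<in> arrows D s X. on_ar M f x = \<zero>\<^bsub>on_ob M s\<^esub>})"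
  have "small \<kappa> (SIGMA s:S. arrows D s X)"
    using locally_small S X unfolding locally_small_def by (intro small_Sigma[OF universe]) auto
  then have A: "small \<kappa> A"
    by (rule small_subset) (auto simp: A_def)
  have F: "fst a \<in> Ob D" if "a \<in> A" for a using that S by (auto simp: A_def)
  obtain W \<iota> where cop: "is_coproduct D A fst W \<iota>"
    using small_coproduct[OF universe coproducts A, of fst] F by blast
  have \<iota>: "\<iota> a \<in> arrows D (fst a) W" if "a \<in> A" for a
    using cop that by (auto simp: is_coproduct_def)
  have W: "W \<in> Ob D" using cop by (simp add: is_coproduct_def)
  have sA: "snd a \<in> arrows D (fst a) X" "on_ar M (snd a) x = \<zero>\<^bsub>on_ob M (fst a)\<^esub>" if "a \<in> A" for a
    using that by (auto simp: A_def)
  obtain w where w: "w \<in> arrows D W X" "\<And>a. a \<in> A \<Longrightarrow> w \<cdot>\<^bsub>D\<^esub> \<iota> a = snd a"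
    using coproduct_map[OF cop X(1) sA(1)] by blast
  obtain X' t h where T: "Tri D W X X' w t h" using Tri_cone[OF W X(1) w(1)] by blast
  note d = TriD[OF T]
  have "on_ar M w x = \<zero>\<^bsub>on_ob M W\<^esub>"
  proof (rule M_coproduct_ext[OF A cop M_closed[OF W X(1) w(1) X(2)] module_zero_closed[OF M_module[OF W]]])
    fix a assume a: "a \<in> A"
    show "on_ar M (\<iota> a) (on_ar M w x) = on_ar M (\<iota> a) \<zero>\<^bsub>on_ob M W\<^esub>"
      using M_cmp[OF F[OF a] W X(1) \<iota>[OF a] w(1) X(2)] w(2)[OF a] sA(2)[OF a] M_zero[OF F[OF a] W \<iota>[OF a]]
      by simp
  qed
  then obtain x' where x': "x' \<in> carrier (on_ob M X')" "on_ar M t x' = x"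
    using M_exact[OF T X(2)] by blast
  have "kills t X x X' s" if s: "s \<in> S" for s
    unfolding kills_def
  proof (intro ballI impI)
    fix f assume "f \<in> arrows D s X" "on_ar M f x = \<zero>\<^bsub>on_ob M s\<^esub>"
    then have a: "(s, f) \<in> A" using s by (simp add: A_def)
    have so: "s \<in> Ob D" and i: "\<iota> (s, f) \<in> arrows D s W" using F[OF a] \<iota>[OF a] by auto
    have "t \<cdot>\<^bsub>D\<^esub> f = (t \<cdot>\<^bsub>D\<^esub> w) \<cdot>\<^bsub>D\<^esub> \<iota> (s, f)"
      using w(2)[OF a] cmp_assoc[OF so W X(1) d(3) i w(1) d(5)] by simp
    then show "t \<cdot>\<^bsub>D\<^esub> f = \<zero>\<^bsub>Hom D s X'\<^esub>"
      using Tri_cmp_zero[OF T] cmp_zero_left[OF so W d(3) i] by simp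
  qed
  moreover have "element_map t X x X' x'"
    using X d x' by (simp add: element_map_def)
  ultimately show thesis using that by blast
qed

text \<open>
  The element keeps covering \<open>S\<close> under every element map, so this is carried along in the
  induction: one more map that kills \<open>S\<close> extends the covering by one factor \<open>Add S\<close>.
\<close>
lemma star_power_cover:
  assumes coproducts: "has_coproducts \<kappa> D" and locally_small: "locally_small \<kappa> D"
    and S: "small \<kappa> S" "S \<subseteq> Ob D"
  shows "\<exists>X x. X \<in> Ob D \<and> x \<in> carrier (on_ob M X) \<and> (\<forall>s\<in>S. covers X x s) \<and>
    (\<forall>Y\<in>star_power D (Add \<kappa> D S) n. covers X x Y)"
proof (induction n)
  case 0
  show ?case using exists_cover[OF coproducts S] by (metis empty_iff star_power.simps(1))
next
  case (Suc n)
  then obtain X x where X: "X \<in> Ob D" "x \<in> carrier (on_ob M X)" and cS: "\<And>s. s \<in> S \<Longrightarrow> covers X x s"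
    and cn: "\<And>Y. Y \<in> star_power D (Add \<kappa> D S) n \<Longrightarrow> covers X x Y" by blast
  have c1: "covers X x Y" if "Y \<in> star_power D (Add \<kappa> D S) (Suc 0)" for Y
    using that covers_summand[OF X covers_Add[OF X cS]] by (auto simp: smd_def)
  show ?case
  proof (cases n)
    case 0
    then show ?thesis using X cS c1 by blast
  next
    case (Suc m)
    obtain t X' x' where t: "element_map t X x X' x'" and kS: "\<And>s. s \<in> S \<Longrightarrow> kills t X x X' s"
      using exists_kill[OF coproducts locally_small S X] by blast
    note e = element_mapD[OF t]
    have k1: "kills t X x X' Y" if "Y \<in> star_power D (Add \<kappa> D S) (Suc 0)" for Y
      using that kills_summand[OF X e(2,5) kills_Add[OF X e(2,5) kS]] by (auto simp: smd_def)
    have "covers X' x' Y"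
      if Y: "Y \<in> star D (star_power D (Add \<kappa> D S) (Suc m)) (star_power D (Add \<kappa> D S) (Suc 0))" for Y
    proof -
      obtain A B f g h where "A \<in> star_power D (Add \<kappa> D S) (Suc m)"
        "B \<in> star_power D (Add \<kappa> D S) (Suc 0)" "Tri D A Y B f g h"
        using Y unfolding star_def by blast
      then show ?thesis
        using covers_extension[OF _ t] cn c1 k1 Suc by blast
    qed
    then have "covers X' x' Y" if "Y \<in> star_power D (Add \<kappa> D S) (Suc (Suc m))" for Y
      using that covers_summand[OF e(2,4)] unfolding star_power.simps(3) smd_def by blast
    moreover have "covers X' x' s" if "s \<in> S" for s
      using covers_push[OF t _ cS[OF that]] S(2) that by blast
    ultimately show ?thesis using e(2,4) Suc by blast
  qed
qed

text \<open>
  Once \<open>x\<close> covers everything, so does its image under any element map.  Hence composing one more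
  map that kills \<open>S\<close> adds one factor \<open>Add S\<close> to what is killed.
\<close>
lemma star_power_kill:
  assumes coproducts: "has_coproducts \<kappa> D" and locally_small: "locally_small \<kappa> D"
    and S: "small \<kappa> S" "S \<subseteq> Ob D"
    and X: "X \<in> Ob D" "x \<in> carrier (on_ob M X)" and c: "\<And>Y. Y \<in> Ob D \<Longrightarrow> covers X x Y"
  shows "\<exists>t X' x'. element_map t X x X' x' \<and>
    (\<forall>Y\<in>star_power D (Add \<kappa> D S) (Suc n). kills t X x X' Y)"
proof (induction n)
  case 0
  obtain t X' x' where t: "element_map t X x X' x'" and kS: "\<And>s. s \<in> S \<Longrightarrow> kills t X x X' s"
    using exists_kill[OF coproducts locally_small S X] by blast
  have "kills t X x X' Y" if "Y \<in> star_power D (Add \<kappa> D S) (Suc 0)" for Y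
    using that kills_summand[OF X element_mapD(2,5)[OF t] kills_Add[OF X element_mapD(2,5)[OF t] kS]]
    by (auto simp: smd_def)
  then show ?case using t by blast
next
  case (Suc n)
  then obtain t X' x' where t: "element_map t X x X' x'"
    and k: "\<And>Y. Y \<in> star_power D (Add \<kappa> D S) (Suc n) \<Longrightarrow> kills t X x X' Y" by blast
  note X' = element_mapD(2,4)[OF t]
  obtain t' X'' x'' where t': "element_map t' X' x' X'' x''" and kS: "\<And>s. s \<in> S \<Longrightarrow> kills t' X' x' X'' s"
    using exists_kill[OF coproducts locally_small S X'] by blast
  note e = element_mapD[OF t']
  have k1: "kills t' X' x' X'' Y" if "Y \<in> star_power D (Add \<kappa> D S) (Suc 0)" for Y
    using that kills_summand[OF X' e(2,5) kills_Add[OF X' e(2,5) kS]] by (auto simp: smd_def)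
  note tt = element_map_cmp[OF t t']
  have "kills (t' \<cdot>\<^bsub>D\<^esub> t) X x X'' Y"
    if Y: "Y \<in> star D (star_power D (Add \<kappa> D S) (Suc n)) (star_power D (Add \<kappa> D S) (Suc 0))" for Y
  proof -
    obtain A B f g h where "A \<in> star_power D (Add \<kappa> D S) (Suc n)"
      "B \<in> star_power D (Add \<kappa> D S) (Suc 0)" and T: "Tri D A Y B f g h"
      using Y unfolding star_def by blast
    then show ?thesis
      using kills_extension[OF T t t'] covers_push[OF t _ c] TriD(1)[OF T] k k1 by blast
  qed
  then have "kills (t' \<cdot>\<^bsub>D\<^esub> t) X x X'' Y" if "Y \<in> star_power D (Add \<kappa> D S) (Suc (Suc n))" for Y
    using that kills_summand[OF X element_mapD(2,5)[OF tt]] unfolding star_power.simps(3) smd_def by blast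
  then show ?case using tt by blast
qed

section \<open>Representability\<close>

lemma representableI:
  assumes Z: "Z \<in> Ob D" and z: "z \<in> carrier (on_ob M Z)"
    and bij: "\<And>Y. Y \<in> Ob D \<Longrightarrow> bij_betw (\<lambda>g. on_ar M g z) (arrows D Y Z) (carrier (on_ob M Y))"
  shows "representable R D M"
proof -
  let ?ev = "\<lambda>g. on_ar M g z"
  define \<phi> where "\<phi> Y = inv_into (arrows D Y Z) ?ev" for Y
  have \<phi>: "\<phi> Y y \<in> arrows D Y Z" "on_ar M (\<phi> Y y) z = y"
    if "Y \<in> Ob D" "y \<in> carrier (on_ob M Y)" for Y y
    using bij_betw_inv_into_right[OF bij[OF that(1)] that(2)]
      bij_betw_apply[OF bij_betw_inv_into[OF bij[OF that(1)]] that(2)]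
    by (simp_all add: \<phi>_def)
  have \<phi>_eq: "\<phi> Y y = g" if "Y \<in> Ob D" "g \<in> arrows D Y Z" "y = on_ar M g z" for Y g y
    using bij_betw_inv_into_left[OF bij[OF that(1)] that(2)] that(3) by (simp add: \<phi>_def)
  have "\<phi> Y \<in> linear_maps R (on_ob M Y) (Hom D Y Z)" if Y: "Y \<in> Ob D" for Y
  proof -
    note lin = evaluation_linear[OF Y Z z]
    have "\<phi> Y (x \<oplus>\<^bsub>on_ob M Y\<^esub> y) = \<phi> Y x \<oplus>\<^bsub>Hom D Y Z\<^esub> \<phi> Y y"
      if "x \<in> carrier (on_ob M Y)" "y \<in> carrier (on_ob M Y)" for x y
      using \<phi>[OF Y that(1)] \<phi>[OF Y that(2)] linear_map_add[OF lin] add_arrow[OF Y Z]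
      by (intro \<phi>_eq[OF Y]) auto
    moreover have "\<phi> Y (a \<odot>\<^bsub>on_ob M Y\<^esub> x) = a \<odot>\<^bsub>Hom D Y Z\<^esub> \<phi> Y x"
      if "a \<in> carrier R" "x \<in> carrier (on_ob M Y)" for a x
      using \<phi>[OF Y that(2)] linear_map_smult[OF lin that(1)] module.smult_closed[OF Hom_module[OF Y Z] that(1)]
      by (intro \<phi>_eq[OF Y]) auto
    ultimately show ?thesis using \<phi>(1)[OF Y] by (simp add: linear_maps_def)
  qed
  moreover have "bij_betw (\<phi> Y) (carrier (on_ob M Y)) (arrows D Y Z)" if "Y \<in> Ob D" for Y
    unfolding \<phi>_def by (rule bij_betw_inv_into[OF bij[OF that]])
  moreover have "\<phi> X (on_ar M f y) = \<phi> Y y \<cdot>\<^bsub>D\<^esub> f"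
    if X: "X \<in> Ob D" and Y: "Y \<in> Ob D" and f: "f \<in> arrows D X Y" and y: "y \<in> carrier (on_ob M Y)" for X Y f y
    using \<phi>[OF Y y] M_cmp[OF X Y Z f _ z] cmp_closed[OF X Y Z f] by (intro \<phi>_eq[OF X]) auto
  ultimately have "contra_naturally_isomorphic R D M (hom_into D Z)"
    unfolding contra_naturally_isomorphic_def hom_into_def by (intro exI[of _ \<phi>]) simp
  then show ?thesis using Z unfolding representable_def by blast
qed

text \<open>
  Write \<open>x' = M f x\<close>.  If two maps into \<open>X\<close> represent the same element of \<open>M\<close>, they agree after
  composition with \<open>t\<close>; so an element represented by \<open>u\<close> determines \<open>t \<cdot> u\<close>, and \<open>M\<close> becomes a
  retract of \<open>Hom(-, X')\<close>.  The corresponding idempotent is \<open>p = t \<cdot> f\<close>, and the object that splits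
  it represents \<open>M\<close>.
\<close>
lemma representable_of_cover_and_kill:
  assumes coproducts: "has_coproducts \<kappa> D" and t: "element_map t X x X' x'"
    and c: "\<And>Y. Y \<in> Ob D \<Longrightarrow> covers X x Y" and k: "\<And>Y. Y \<in> Ob D \<Longrightarrow> kills t X x X' Y"
  shows "representable R D M"
proof -
  note e = element_mapD[OF t]
  note X = e(1,3) and X' = e(2,4) and t' = e(5)
  have surj: "\<exists>u\<in>arrows D Y X. on_ar M u x = y" if Y: "Y \<in> Ob D" and y: "y \<in> carrier (on_ob M Y)" for Y y
  proof -
    obtain V \<epsilon> where V: "V \<in> Ob D" and iso: "is_iso D (sh_ob D V) Y \<epsilon>"
      using susp_essentially_surjective[OF Y] by blast
    note sV = sh_ob_closed[OF V]
    obtain \<delta> where \<epsilon>: "\<epsilon> \<in> arrows D (sh_ob D V) Y" and \<delta>: "\<delta> \<in> arrows D Y (sh_ob D V)"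
      and \<epsilon>\<delta>: "\<epsilon> \<cdot>\<^bsub>D\<^esub> \<delta> = ident D Y"
      using is_isoE[OF iso] by metis
    obtain u where u: "u \<in> arrows D (sh_ob D V) X" "on_ar M u x = on_ar M \<epsilon> y"
      using coversE[OF c[OF V] M_closed[OF sV Y \<epsilon> y]] by blast
    have "on_ar M (u \<cdot>\<^bsub>D\<^esub> \<delta>) x = y"
      using M_cmp[OF Y sV X(1) \<delta> u(1) X(2)] u(2) M_cmp[OF Y sV Y \<delta> \<epsilon> y] \<epsilon>\<delta> M_ident[OF Y y] by simp
    then show ?thesis using cmp_closed[OF Y sV X(1) \<delta> u(1)] by blast
  qed
  have eq: "t \<cdot>\<^bsub>D\<^esub> u = t \<cdot>\<^bsub>D\<^esub> v"
    if Y: "Y \<in> Ob D" and u: "u \<in> arrows D Y X" and v: "v \<in> arrows D Y X" and uv: "on_ar M u x = on_ar M v x"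
    for Y u v
  proof -
    have "on_ar M (u \<ominus>\<^bsub>Hom D Y X\<^esub> v) x = \<zero>\<^bsub>on_ob M Y\<^esub>"
      using M_minus_arrow[OF Y X(1) u v X(2)] uv M_closed[OF Y X(1) v X(2)]
        module_minus_eq_zero_iff[OF M_module[OF Y]] by simp
    then have "t \<cdot>\<^bsub>D\<^esub> (u \<ominus>\<^bsub>Hom D Y X\<^esub> v) = \<zero>\<^bsub>Hom D Y X'\<^esub>"
      by (rule killsD[OF k[OF Y] minus_arrow[OF Y X(1) u v]])
    then show ?thesis
      using cmp_minus_right[OF Y X(1) X'(1) t' u v] minus_arrow_eq_zero_iff[OF Y X'(1)]
        cmp_closed[OF Y X(1) X'(1) _ t'] u v by simp
  qed
  obtain f where f: "f \<in> arrows D X' X" "on_ar M f x = x'" using surj[OF X'] by blast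
  define p where "p = t \<cdot>\<^bsub>D\<^esub> f"
  have p: "p \<in> arrows D X' X'" unfolding p_def by (rule cmp_closed[OF X'(1) X(1) X'(1) f(1) t'])
  have px: "on_ar M p x' = x'"
    unfolding p_def using element_map_push[OF t X'(1) f(1)] f(2) by simp
  note fp = cmp_closed[OF X'(1) X'(1) X(1) p f(1)]
  have "t \<cdot>\<^bsub>D\<^esub> (f \<cdot>\<^bsub>D\<^esub> p) = t \<cdot>\<^bsub>D\<^esub> f"
    using M_cmp[OF X'(1) X'(1) X(1) p f(1) X(2)] f(2) px by (intro eq[OF X'(1) fp f(1)]) simp
  then have pp: "p \<cdot>\<^bsub>D\<^esub> p = p"
    using cmp_assoc[OF X'(1) X'(1) X(1) X'(1) p f(1) t'] by (simp add: p_def)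
  obtain P \<iota> where "is_coproduct D (UNIV :: nat set) (\<lambda>_. X') P \<iota>"
    using small_coproduct[OF universe coproducts small_nat[OF universe], of "\<lambda>_. X'"] X' by blast
  then obtain Z q i where Z: "Z \<in> Ob D" and q: "q \<in> arrows D X' Z" and i: "i \<in> arrows D Z X'"
    and qi: "q \<cdot>\<^bsub>D\<^esub> i = ident D Z" and iq: "i \<cdot>\<^bsub>D\<^esub> q = p"
    using idempotent_splits[OF X'(1) p pp] by blast
  define z where "z = on_ar M i x'"
  have z: "z \<in> carrier (on_ob M Z)" unfolding z_def by (rule M_closed[OF Z X'(1) i X'(2)])
  have ev: "on_ar M g z = on_ar M (i \<cdot>\<^bsub>D\<^esub> g) x'" if "Y \<in> Ob D" "g \<in> arrows D Y Z" for Y g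
    using M_cmp[OF that(1) Z X'(1) that(2) i X'(2)] by (simp add: z_def)
  have "bij_betw (\<lambda>g. on_ar M g z) (arrows D Y Z) (carrier (on_ob M Y))" if Y: "Y \<in> Ob D" for Y
    unfolding bij_betw_def
  proof (intro conjI inj_onI equalityI subsetI)
    \<comment> \<open>The map \<open>i\<close> is fixed by \<open>p\<close>, so \<open>i \<cdot> g\<close> depends only on the element that \<open>f \<cdot> i \<cdot> g\<close> represents.\<close>
    have rec: "i \<cdot>\<^bsub>D\<^esub> g = t \<cdot>\<^bsub>D\<^esub> (f \<cdot>\<^bsub>D\<^esub> (i \<cdot>\<^bsub>D\<^esub> g))" if g: "g \<in> arrows D Y Z" for g
    proof -
      note ig = cmp_closed[OF Y Z X'(1) g i]
      have "t \<cdot>\<^bsub>D\<^esub> (f \<cdot>\<^bsub>D\<^esub> (i \<cdot>\<^bsub>D\<^esub> g)) = i \<cdot>\<^bsub>D\<^esub> (q \<cdot>\<^bsub>D\<^esub> (i \<cdot>\<^bsub>D\<^esub> g))"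
        using cmp_assoc[OF Y X'(1) X(1) X'(1) ig f(1) t'] cmp_assoc[OF Y X'(1) Z X'(1) ig q i] iq
        by (simp add: p_def)
      also have "\<dots> = i \<cdot>\<^bsub>D\<^esub> g"
        using cmp_assoc[OF Y Z X'(1) Z g i q] qi cmp_ident_left[OF Y Z g] by simp
      finally show ?thesis by simp
    qed
    fix g g' assume g: "g \<in> arrows D Y Z" and g': "g' \<in> arrows D Y Z" and gg: "on_ar M g z = on_ar M g' z"
    note ig = cmp_closed[OF Y Z X'(1) g i] and ig' = cmp_closed[OF Y Z X'(1) g' i]
    note fig = cmp_closed[OF Y X'(1) X(1) ig f(1)] and fig' = cmp_closed[OF Y X'(1) X(1) ig' f(1)]
    have "on_ar M (f \<cdot>\<^bsub>D\<^esub> (i \<cdot>\<^bsub>D\<^esub> g)) x = on_ar M (f \<cdot>\<^bsub>D\<^esub> (i \<cdot>\<^bsub>D\<^esub> g')) x"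
      using M_cmp[OF Y X'(1) X(1) ig f(1) X(2)] M_cmp[OF Y X'(1) X(1) ig' f(1) X(2)] f(2)
        ev[OF Y g] ev[OF Y g'] gg by simp
    then have "i \<cdot>\<^bsub>D\<^esub> g = i \<cdot>\<^bsub>D\<^esub> g'"
      using eq[OF Y fig fig'] rec[OF g] rec[OF g'] by simp
    moreover have "q \<cdot>\<^bsub>D\<^esub> (i \<cdot>\<^bsub>D\<^esub> u) = u" if "u \<in> arrows D Y Z" for u
      using cmp_assoc[OF Y Z X'(1) Z that i q] qi cmp_ident_left[OF Y Z that] by simp
    ultimately show "g = g'" using g g' by metis
  next
    fix y assume "y \<in> (\<lambda>g. on_ar M g z) ` arrows D Y Z"
    then show "y \<in> carrier (on_ob M Y)" using M_closed[OF Y Z _ z] by blast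
  next
    fix y assume y: "y \<in> carrier (on_ob M Y)"
    obtain u where u: "u \<in> arrows D Y X" "on_ar M u x = y" using surj[OF Y y] by blast
    note tu = cmp_closed[OF Y X(1) X'(1) u(1) t']
    have "on_ar M (q \<cdot>\<^bsub>D\<^esub> (t \<cdot>\<^bsub>D\<^esub> u)) z = on_ar M (p \<cdot>\<^bsub>D\<^esub> (t \<cdot>\<^bsub>D\<^esub> u)) x'"
      using ev[OF Y cmp_closed[OF Y X'(1) Z tu q]] cmp_assoc[OF Y X'(1) Z X'(1) tu q i] iq by simp
    also have "\<dots> = y"
      using M_cmp[OF Y X'(1) X'(1) tu p X'(2)] px element_map_push[OF t Y u(1)] u(2) by simp
    finally show "y \<in> (\<lambda>g. on_ar M g z) ` arrows D Y Z"
      using cmp_closed[OF Y X'(1) Z tu q] by blast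
  qed
  then show ?thesis by (rule representableI[OF Z z])
qed

theorem representable_if_strongly_generated:
  assumes "has_coproducts \<kappa> D" "locally_small \<kappa> D" "small \<kappa> S" "S \<subseteq> Ob D"
    and gen: "Ob D = star_power D (Add \<kappa> D S) n"
  shows "representable R D M"
proof -
  have "n \<noteq> 0"
  proof
    assume "n = 0"
    then have "Ob D = {}" using gen by simp
    then show False using zero_object by (simp add: is_zero_object_def)
  qed
  then obtain m where n: "n = Suc m" by (cases n) auto
  obtain X x where X: "X \<in> Ob D" "x \<in> carrier (on_ob M X)" and c: "\<And>Y. Y \<in> Ob D \<Longrightarrow> covers X x Y"
    using star_power_cover[OF assms(1-4), of n] gen by blast
  obtain t X' x' where "element_map t X x X' x'" "\<And>Y. Y \<in> Ob D \<Longrightarrow> kills t X x X' Y"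
    using star_power_kill[OF assms(1-4) X c, of m] gen n by blast
  then show ?thesis using representable_of_cover_and_kill[OF assms(1) _ c] by blast
qed

end

section \<open>Properties of representable functors\<close>

lemma contravariant_functor_closed:
  assumes "contravariant_functor \<kappa> R C M" "X \<in> Ob C" "Y \<in> Ob C" "f \<in> arrows C X Y" "x \<in> carrier (on_ob M Y)"
  shows "on_ar M f x \<in> carrier (on_ob M X)"
proof -
  have "on_ar M f \<in> linear_maps R (on_ob M Y) (on_ob M X)"
    using assms(1-4) by (simp add: contravariant_functor_def)
  then show ?thesis using assms(5) by (rule linear_map_closed)
qed

context linear_triangulated_category
begin

lemma representableE:
  assumes "representable R D M"
  obtains W \<phi> where "W \<in> Ob D"
    "\<And>X. X \<in> Ob D \<Longrightarrow> \<phi> X \<in> linear_maps R (on_ob M X) (Hom D X W)"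
    "\<And>X. X \<in> Ob D \<Longrightarrow> bij_betw (\<phi> X) (carrier (on_ob M X)) (arrows D X W)"
    "\<And>X Y f x. \<lbrakk>X \<in> Ob D; Y \<in> Ob D; f \<in> arrows D X Y; x \<in> carrier (on_ob M Y)\<rbrakk>
      \<Longrightarrow> \<phi> X (on_ar M f x) = \<phi> Y x \<cdot>\<^bsub>D\<^esub> f"
proof -
  obtain W where W: "W \<in> Ob D" and "contra_naturally_isomorphic R D M (hom_into D W)"
    using assms by (auto simp: representable_def)
  then obtain \<phi> where a: "\<forall>X\<in>Ob D. \<phi> X \<in> linear_maps R (on_ob M X) (Hom D X W) \<and>
      bij_betw (\<phi> X) (carrier (on_ob M X)) (arrows D X W)"
    and b: "\<forall>X\<in>Ob D. \<forall>Y\<in>Ob D. \<forall>f\<in>arrows D X Y. \<forall>x\<in>carrier (on_ob M Y).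
      \<phi> X (on_ar M f x) = \<phi> Y x \<cdot>\<^bsub>D\<^esub> f"
    unfolding contra_naturally_isomorphic_def hom_into_def functor_data.simps by blast
  show thesis
    by (rule that[OF W, of \<phi>]) (use a b in simp_all)
qed

lemma representable_cohomological:
  assumes M: "contravariant_functor \<kappa> R D M" and "representable R D M"
  shows "cohomological D M"
proof -
  obtain W \<phi> where W: "W \<in> Ob D"
    and lin: "\<And>X. X \<in> Ob D \<Longrightarrow> \<phi> X \<in> linear_maps R (on_ob M X) (Hom D X W)"
    and bij: "\<And>X. X \<in> Ob D \<Longrightarrow> bij_betw (\<phi> X) (carrier (on_ob M X)) (arrows D X W)"
    and nat: "\<And>X Y f x. \<lbrakk>X \<in> Ob D; Y \<in> Ob D; f \<in> arrows D X Y; x \<in> carrier (on_ob M Y)\<rbrakk>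
      \<Longrightarrow> \<phi> X (on_ar M f x) = \<phi> Y x \<cdot>\<^bsub>D\<^esub> f"
    using representableE[OF assms(2)] by metis
  have Mm: "module R (on_ob M X)" if "X \<in> Ob D" for X
    using M that by (simp add: contravariant_functor_def)
  have Mc: "on_ar M f x \<in> carrier (on_ob M X)"
    if "X \<in> Ob D" "Y \<in> Ob D" "f \<in> arrows D X Y" "x \<in> carrier (on_ob M Y)" for X Y f x
    by (rule contravariant_functor_closed[OF M that])
  have inj: "x = y" if "X \<in> Ob D" "x \<in> carrier (on_ob M X)" "y \<in> carrier (on_ob M X)" "\<phi> X x = \<phi> X y" for X x y
    using bij[OF that(1)] that(2-4) by (auto simp: bij_betw_def dest: inj_onD)
  have \<phi>c: "\<phi> X x \<in> arrows D X W" if "X \<in> Ob D" "x \<in> carrier (on_ob M X)" for X x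
    by (rule linear_map_closed[OF lin[OF that(1)] that(2)])
  have \<phi>0: "\<phi> X \<zero>\<^bsub>on_ob M X\<^esub> = \<zero>\<^bsub>Hom D X W\<^esub>" if "X \<in> Ob D" for X
    by (rule linear_map_zero[OF Mm[OF that] Hom_module[OF that W] lin[OF that]])
  have "on_ar M g ` carrier (on_ob M Z) = {y \<in> carrier (on_ob M Y). on_ar M f y = \<zero>\<^bsub>on_ob M X\<^esub>}"
    if T: "Tri D X Y Z f g h" for X Y Z f g h
  proof (intro equalityI subsetI)
    note d = TriD[OF T]
    fix y assume "y \<in> on_ar M g ` carrier (on_ob M Z)"
    then obtain z where z: "z \<in> carrier (on_ob M Z)" and y: "y = on_ar M g z" by blast
    have yc: "y \<in> carrier (on_ob M Y)" unfolding y by (rule Mc[OF d(2,3,5) z])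
    have "\<phi> X (on_ar M f y) = (\<phi> Z z \<cdot>\<^bsub>D\<^esub> g) \<cdot>\<^bsub>D\<^esub> f"
      using nat[OF d(1,2,4) yc] nat[OF d(2,3,5) z] y by simp
    also have "\<dots> = \<phi> X \<zero>\<^bsub>on_ob M X\<^esub>"
      using cmp_assoc[OF d(1-3) W d(4,5) \<phi>c[OF d(3) z]] Tri_cmp_zero[OF T]
        cmp_zero_right[OF d(1,3) W \<phi>c[OF d(3) z]] \<phi>0[OF d(1)] by simp
    finally have "on_ar M f y = \<zero>\<^bsub>on_ob M X\<^esub>"
      by (rule inj[OF d(1) Mc[OF d(1,2,4) yc] module_zero_closed[OF Mm[OF d(1)]]])
    then show "y \<in> {y \<in> carrier (on_ob M Y). on_ar M f y = \<zero>\<^bsub>on_ob M X\<^esub>}" using yc by simp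
  next
    note d = TriD[OF T]
    fix y assume "y \<in> {y \<in> carrier (on_ob M Y). on_ar M f y = \<zero>\<^bsub>on_ob M X\<^esub>}"
    then have y: "y \<in> carrier (on_ob M Y)" and fy: "on_ar M f y = \<zero>\<^bsub>on_ob M X\<^esub>" by auto
    have "\<phi> Y y \<cdot>\<^bsub>D\<^esub> f = \<zero>\<^bsub>Hom D X W\<^esub>"
      using nat[OF d(1,2,4) y] fy \<phi>0[OF d(1)] by simp
    then obtain w where w: "w \<in> arrows D Z W" "w \<cdot>\<^bsub>D\<^esub> g = \<phi> Y y"
      using Tri_extend[OF T W \<phi>c[OF d(2) y]] by blast
    have "w \<in> \<phi> Z ` carrier (on_ob M Z)"
      using bij_betw_imp_surj_on[OF bij[OF d(3)]] w(1) by simp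
    then obtain z where z: "w = \<phi> Z z" "z \<in> carrier (on_ob M Z)" by (rule imageE)
    have "\<phi> Y (on_ar M g z) = \<phi> Y y" using nat[OF d(2,3,5) z(2)] z(1) w(2) by simp
    then have "on_ar M g z = y" by (rule inj[OF d(2) Mc[OF d(2,3,5) z(2)] y])
    then show "y \<in> on_ar M g ` carrier (on_ob M Z)" using z(2) by blast
  qed
  then show ?thesis unfolding cohomological_def by blast
qed

lemma representable_coproducts_to_products:
  assumes M: "contravariant_functor \<kappa> R D M" and "representable R D M"
  shows "coproducts_to_products \<kappa> D M"
proof -
  obtain W \<phi> where W: "W \<in> Ob D"
    and bij: "\<And>X. X \<in> Ob D \<Longrightarrow> bij_betw (\<phi> X) (carrier (on_ob M X)) (arrows D X W)"
    and nat: "\<And>X Y f x. \<lbrakk>X \<in> Ob D; Y \<in> Ob D; f \<in> arrows D X Y; x \<in> carrier (on_ob M Y)\<rbrakk>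
      \<Longrightarrow> \<phi> X (on_ar M f x) = \<phi> Y x \<cdot>\<^bsub>D\<^esub> f"
    using representableE[OF assms(2)] by metis
  have Mc: "on_ar M f x \<in> carrier (on_ob M X)"
    if "X \<in> Ob D" "Y \<in> Ob D" "f \<in> arrows D X Y" "x \<in> carrier (on_ob M Y)" for X Y f x
    by (rule contravariant_functor_closed[OF M that])
  have inj: "x = y" if "X \<in> Ob D" "x \<in> carrier (on_ob M X)" "y \<in> carrier (on_ob M X)" "\<phi> X x = \<phi> X y" for X x y
    using bij[OF that(1)] that(2-4) by (auto simp: bij_betw_def dest: inj_onD)
  have \<phi>c: "\<phi> X x \<in> arrows D X W" if "X \<in> Ob D" "x \<in> carrier (on_ob M X)" for X x
    using bij[OF that(1)] that(2) by (auto simp: bij_betw_def)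
  have "bij_betw (\<lambda>x. \<lambda>i\<in>I. on_ar M (\<iota> i) x) (carrier (on_ob M S)) (\<Pi>\<^sub>E i\<in>I. carrier (on_ob M (F i)))"
    if cop: "is_coproduct D I F S \<iota>" for I :: "'i set" and F S \<iota>
    unfolding bij_betw_def
  proof (intro conjI inj_onI equalityI subsetI)
    have F: "F i \<in> Ob D" and \<iota>: "\<iota> i \<in> arrows D (F i) S" if "i \<in> I" for i
      using cop that by (auto simp: is_coproduct_def)
    have S: "S \<in> Ob D" using cop by (auto simp: is_coproduct_def)
    {
      fix x y assume x: "x \<in> carrier (on_ob M S)" and y: "y \<in> carrier (on_ob M S)"
        and eq: "(\<lambda>i\<in>I. on_ar M (\<iota> i) x) = (\<lambda>i\<in>I. on_ar M (\<iota> i) y)"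
      have "\<phi> S x = \<phi> S y"
      proof (rule coproduct_ext[OF cop W \<phi>c[OF S x] \<phi>c[OF S y]])
        fix i assume i: "i \<in> I"
        have "on_ar M (\<iota> i) x = on_ar M (\<iota> i) y" using fun_cong[OF eq, of i] i by simp
        then show "\<phi> S x \<cdot>\<^bsub>D\<^esub> \<iota> i = \<phi> S y \<cdot>\<^bsub>D\<^esub> \<iota> i"
          using nat[OF F[OF i] S \<iota>[OF i] x] nat[OF F[OF i] S \<iota>[OF i] y] by simp
      qed
      then show "x = y" by (rule inj[OF S x y])
    next
      fix y assume "y \<in> (\<lambda>x. \<lambda>i\<in>I. on_ar M (\<iota> i) x) ` carrier (on_ob M S)"
      then show "y \<in> (\<Pi>\<^sub>E i\<in>I. carrier (on_ob M (F i)))"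
        using Mc[OF F S \<iota>] by (auto simp: PiE_iff)
    next
      fix y assume y: "y \<in> (\<Pi>\<^sub>E i\<in>I. carrier (on_ob M (F i)))"
      then have yi: "y i \<in> carrier (on_ob M (F i))" if "i \<in> I" for i using that by auto
      obtain w where w: "w \<in> arrows D S W" "\<And>i. i \<in> I \<Longrightarrow> w \<cdot>\<^bsub>D\<^esub> \<iota> i = \<phi> (F i) (y i)"
        using coproduct_map[OF cop W \<phi>c[OF F yi]] by metis
      have "w \<in> \<phi> S ` carrier (on_ob M S)"
        using bij_betw_imp_surj_on[OF bij[OF S]] w(1) by simp
      then obtain x where x: "w = \<phi> S x" "x \<in> carrier (on_ob M S)" by (rule imageE)
      have "on_ar M (\<iota> i) x = y i" if i: "i \<in> I" for i
        using nat[OF F[OF i] S \<iota>[OF i] x(2)] x(1) w(2)[OF i]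
        by (intro inj[OF F[OF i] Mc[OF F[OF i] S \<iota>[OF i] x(2)] yi[OF i]]) simp
      then have "(\<lambda>i\<in>I. on_ar M (\<iota> i) x) = y"
        using y by (auto simp: PiE_iff extensional_def fun_eq_iff)
      then show "y \<in> (\<lambda>x. \<lambda>i\<in>I. on_ar M (\<iota> i) x) ` carrier (on_ob M S)" using x(2) by blast
    }
  qed
  then show ?thesis unfolding coproducts_to_products_def by blast
qed

lemma shift_closed: "X \<in> Ob D \<Longrightarrow> shift D X n \<in> Ob D"
proof -
  assume X: "X \<in> Ob D"
  have "(on_ob F ^^ k) X \<in> Ob D" if "linear_functor R D D F" for F k
    using X functor_ob[OF that] by (induction k) auto
  then show ?thesis
    using susp_functor desusp_functor by (simp add: shift_def)
qed

end

lemma small_shifts: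
  assumes "universe_cardinal \<kappa>" "small \<kappa> G"
  shows "small \<kappa> (shifts D G)"
proof -
  have "small \<kappa> (UNIV :: int set)"
  proof -
    have "UNIV = (\<lambda>(m, n). int m - int n) ` (UNIV \<times> UNIV)"
      by (auto simp: image_iff) (metis int_diff_cases)
    then show ?thesis
      using small_image[OF small_Sigma[OF assms(1) small_nat[OF assms(1)] small_nat[OF assms(1)]]] by metis
  qed
  then have "small \<kappa> (G \<times> (UNIV :: int set))"
    using small_Sigma[OF assms(1,2), of "\<lambda>_. UNIV :: int set"] by blast
  moreover have "shifts D G = (\<lambda>(X, n). shift D X n) ` (G \<times> UNIV)"
    by (auto simp: shifts_def)
  ultimately show ?thesis using small_image by metis
qed

section \<open>Brown representability for strongly generated categories\<close>

theorem corollary2p4: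
  fixes \<kappa> :: "'u rel"
    and R :: "'r ring"
    and D :: "('r, 'o, 'm) tri_cat"
    and M :: "('r, 'o, 'm, 'x) module_functor"
    and G :: "'o set"
  assumes "universe_cardinal \<kappa>"
    and "cring R"
    and "linear_triangulated_category R D"
    and "locally_small \<kappa> D"
    and "has_coproducts \<kappa> D"
    and "contravariant_functor \<kappa> R D M"
    and "G \<subseteq> Ob D" and "small \<kappa> G"
    and "\<exists>n\<ge>1. Ob D = star_power D (Add \<kappa> D (shifts D G)) n"
  shows "representable R D M \<longleftrightarrow> cohomological D M \<and> coproducts_to_products \<kappa> D M"
proof
  interpret linear_triangulated_category R D by fact
  assume "representable R D M"
  then show "cohomological D M \<and> coproducts_to_products \<kappa> D M"
    using representable_cohomological representable_coproducts_to_products assms(6) by blast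
next
  interpret linear_triangulated_category R D by fact
  assume M: "cohomological D M \<and> coproducts_to_products \<kappa> D M"
  interpret cohomological_functor R D \<kappa> M
    using M assms(1,6) by unfold_locales auto
  have "shifts D G \<subseteq> Ob D"
    using assms(7) shift_closed by (auto simp: shifts_def)
  then show "representable R D M"
    using assms(9) representable_if_strongly_generated[OF assms(5,4) small_shifts[OF assms(1,8)]] by blast
qed

end
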